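(* Let $\lambda>\lambda_0=3/2^{2/3}$. For any given positive integer $m$ there is an $\varepsilon_m>0$ such that for $\varepsilon\in(0,\varepsilon_m)$, the equation $\varepsilon^2u''=u^3-\lambda u+\cos t$ has a solution $u$ (depending on $\varepsilon$) such that $u'(0)=u'(\pi)=0$, $u(\pi/2)=0$, $u'(\pi/2)<0$, and $u$ has $m$ minima and $m$ maxima in $[\pi/2,\pi]$. If we denote these minima and maxima by $s_j$ and $t_j$ respectively, with $1\le j\le m$, then $$\frac{\pi}{2}<s_1<t_1<s_2<t_2<\cdots<s_m<t_m=\pi,$$ $$\lim_{\varepsilon\to0}s_1=\cdots=\lim_{\varepsilon\to0}s_m=\frac{\pi}{2},\qquad \lim_{\varepsilon\to0}u(s_1)=\cdots=\lim_{\varepsilon\to0}u(s_m)=\underline U\Big(\frac{\pi}{2}\Big),$$ $$\lim_{\varepsilon\to0}t_1=\cdots=\lim_{\varepsilon\to0}t_{m-1}=\frac{\pi}{2},\qquad \lim_{\varepsilon\to0}u(t_1)=\cdots=\lim_{\varepsilon\to0}u(t_{m-1})=\bar U\Big(\frac{\pi}{2}\Big),$$ $$u'(t)>0,\quad \underline U\Big(\frac{\pi}{2}\Big)<u(t)<\underline U(\pi)\quad\text{for } s_m<t<\pi.$$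
   Context: For $\lambda>\lambda_0$, $\bar U(t)>U_0(t)>\underline U(t)$ denote the three real roots of $u^3-\lambda u+\cos t=0$. *)

theory Defs
  imports Complex_Main
begin

definition cubic_roots :: "real \<Rightarrow> real \<Rightarrow> real set" where
  "cubic_roots lam t = {x. x ^ 3 - lam * x + cos t = 0}"

definition U_upper :: "real \<Rightarrow> real \<Rightarrow> real" where
  "U_upper lam t = Max (cubic_roots lam t)"

definition U_lower :: "real \<Rightarrow> real \<Rightarrow> real" where
  "U_lower lam t = Min (cubic_roots lam t)"

text \<open>Above the threshold the cubic has exactly three real roots, so the two definitions above
  really pick out the largest and the smallest one (\<open>Max\<close> and \<open>Min\<close> are only meaningful on finite
  nonempty sets).\<close>

lemma cubic_roots_three:
  assumes "lam > 3 / 2 powr (2 / 3)"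
  shows "\<exists>x. cubic_roots lam t = {U_lower lam t, x, U_upper lam t} \<and> U_lower lam t < x \<and> x < U_upper lam t"
proof -
  define a where "a = sqrt (lam / 3)"
  define f where "f = (\<lambda>x::real. x ^ 3 - lam * x + cos t)"
  have l0: "lam > 0" using assms by (smt (verit) divide_pos_pos powr_gt_zero)
  have a0: "a > 0" and a2: "lam = 3 * a ^ 2" using l0 by (auto simp: a_def)
  have p: "((2::real) powr (2 / 3)) ^ 3 = 4" by (simp add: powr_power)
  have "(3 / 2 powr (2 / 3)) ^ 3 < lam ^ 3"
    using assms by (intro power_strict_mono) auto
  then have "27 / 4 < lam ^ 3" by (simp add: power_divide p)
  then have "1 / 4 < a ^ 6" by (simp add: a2 power_mult_distrib flip: power_mult)
  then have "(1 / 2) ^ 2 < (a ^ 3) ^ 2" by (simp add: power_divide flip: power_mult)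
  then have a3: "1 / 2 < a ^ 3" using a0 by (meson power_less_imp_less_base less_imp_le zero_less_power)
  have c: "- 1 \<le> cos t" "cos t \<le> 1" by auto
  have v: "f (- (2 * a)) < 0" "f (- a) > 0" "f a < 0" "f (2 * a) > 0"
  proof -
    have "f (- (2 * a)) = cos t - 2 * a ^ 3" "f (- a) = cos t + 2 * a ^ 3"
      "f a = cos t - 2 * a ^ 3" "f (2 * a) = cos t + 2 * a ^ 3"
      by (simp_all add: f_def a2 power2_eq_square power3_eq_cube)
    then show "f (- (2 * a)) < 0" "f (- a) > 0" "f a < 0" "f (2 * a) > 0"
      using a3 c by linarith+
  qed
  have ct: "continuous_on S f" for S unfolding f_def by (intro continuous_intros)
  obtain x where x: "- (2 * a) \<le> x" "x \<le> - a" "f x = 0"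
    using IVT'[of f "- (2 * a)" 0 "- a"] v a0 ct by force
  obtain y where y: "- a \<le> y" "y \<le> a" "f y = 0"
    using IVT2'[of f a 0 "- a"] v a0 ct by force
  obtain z where z: "a \<le> z" "z \<le> 2 * a" "f z = 0"
    using IVT'[of f a 0 "2 * a"] v a0 ct by force
  have "x \<noteq> - a" "z \<noteq> a" using x z v by auto
  then have xy: "x < y" and yz: "y < z" using x y z by linarith+
  have three: "w = x \<or> w = y \<or> w = z" if w: "f w = 0" for w
  proof (rule ccontr)
    assume n: "\<not> ?thesis"
    have q: "p ^ 2 + p * q + q ^ 2 = lam" if "f p = 0" "f q = 0" "p \<noteq> q" for p q
    proof -
      have "(p - q) * (p ^ 2 + p * q + q ^ 2 - lam) = 0"
        using that(1,2) by (simp add: f_def algebra_simps power2_eq_square power3_eq_cube)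
      then show ?thesis using that(3) by simp
    qed
    have s: "p + q + r = 0" if "f p = 0" "f q = 0" "f r = 0" "p \<noteq> q" "q \<noteq> r" "p \<noteq> r" for p q r
    proof -
      have "(q - r) * (p + q + r) = 0"
        using q[of p q] q[of p r] that by (simp add: algebra_simps power2_eq_square)
      then show ?thesis using that by simp
    qed
    from s[of x y z] s[of x y w] show False using n xy yz x y z w by auto
  qed
  have R: "cubic_roots lam t = {x, y, z}"
    using three x y z by (auto simp: cubic_roots_def f_def)
  have "U_lower lam t = x" "U_upper lam t = z"
    using xy yz by (auto simp: U_lower_def U_upper_def R)
  then show ?thesis using R xy yz by auto
qed

text \<open>\<open>u\<close> solves \<open>\<epsilon>\<^sup>2 u'' = u\<^sup>3 - lam u + cos t\<close> on \<open>[0, \<pi>]\<close> and \<open>u'\<close> is its derivative;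
  derivatives are one-sided at the two end points.\<close>

definition forced_duffing_solution ::
    "real \<Rightarrow> real \<Rightarrow> (real \<Rightarrow> real) \<Rightarrow> (real \<Rightarrow> real) \<Rightarrow> bool" where
  "forced_duffing_solution lam \<epsilon> u u' \<longleftrightarrow>
     (\<exists>u''. \<forall>t\<in>{0..pi}.
        (u has_real_derivative u' t) (at t within {0..pi}) \<and>
        (u' has_real_derivative u'' t) (at t within {0..pi}) \<and>
        \<epsilon>\<^sup>2 * u'' t = u t ^ 3 - lam * u t + cos t)"

text \<open>Local extrema relative to a set \<open>S\<close>, so that an end point of an interval can be one.\<close>

definition local_min_on :: "(real \<Rightarrow> real) \<Rightarrow> real set \<Rightarrow> real \<Rightarrow> bool" where
  "local_min_on f S x \<longleftrightarrow> x \<in> S \<and> (\<forall>\<^sub>F y in at x within S. f x \<le> f y)"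

definition local_max_on :: "(real \<Rightarrow> real) \<Rightarrow> real set \<Rightarrow> real \<Rightarrow> bool" where
  "local_max_on f S x \<longleftrightarrow> x \<in> S \<and> (\<forall>\<^sub>F y in at x within S. f y \<le> f x)"

text \<open>In the next two sets the extrema are those of a function on its whole domain \<open>[0, \<pi>]\<close> that happen to
  lie in \<open>[\<pi>/2, \<pi>]\<close>: the end point \<open>\<pi>\<close> can be one of them, while \<open>\<pi>/2\<close> is an interior
  point of the domain and not an extremum when the derivative there is nonzero.\<close>

definition minima_right_half :: "(real \<Rightarrow> real) \<Rightarrow> real set" where
  "minima_right_half u = {x \<in> {pi/2..pi}. local_min_on u {0..pi} x}"

definition maxima_right_half :: "(real \<Rightarrow> real) \<Rightarrow> real set" where
  "maxima_right_half u = {x \<in> {pi/2..pi}. local_max_on u {0..pi} x}"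

end

theory Submission
  imports Defs "HOL-Analysis.Analysis"
begin

text \<open>By the symmetry \<open>u(\<pi> - t) = - u(t)\<close> it is enough to solve on \<open>[\<pi>/2, \<pi>]\<close> with
  \<open>u(\<pi>/2) = 0\<close> and \<open>u'(\<pi>) = 0\<close>. We shoot backwards from \<open>\<pi>\<close>, in the time
  \<open>\<tau> = \<pi> - t\<close>, with \<open>u(\<pi>) = b\<close> below the smallest root of \<open>x^3 - \<lambda> x = 1\<close>. Such an orbit
  first falls. If it turns before \<open>\<tau> = \<pi>/2\<close>, then, since the forcing decreases towards
  \<open>\<tau> = \<pi>/2\<close>, an energy argument traps it strictly between its turning level and \<open>sqrt \<lambda>\<close>,
  and from then on it rotates around the origin of the phase plane. For some \<open>b\<close> the turning time
  is \<open>\<pi>/2 - \<delta>\<close> and the polar angle of \<open>(- u, \<epsilon> u')\<close> at \<open>\<tau> = \<pi>/2\<close> is of order \<open>1/\<epsilon>\<close>; for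
  \<open>b = - sqrt \<lambda>\<close> there is no turning point and this angle is below \<open>\<pi>/2\<close>. For all \<open>b\<close> in between
  the turning time, if any, is at least \<open>\<pi>/2 - \<delta>\<close> and the orbit avoids the origin, so the angle depends
  continuously on \<open>b\<close> and takes the value \<open>2 (m - 1) \<pi> + \<pi>/2\<close>. This gives exactly \<open>m\<close>
  minima, all of them within \<open>\<delta>\<close> of \<open>\<pi>/2\<close>; there the energy is close to that of the saddles
  \<open>\<plusminus> sqrt \<lambda>\<close>, which locates the extremal values.\<close>

section \<open>Global solutions of a second order initial value problem\<close>

text \<open>The intermediate value argument is applied to the angle at time \<pi>/2 and not to the
  turning time: the angle is an integral over all of [0, \<pi>/2], so it is defined and continuous
  in \<open>b\<close> also across orbits that never turn. The obstacle is to keep every orbit in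
  between off the origin. A late turn helps twice: it leaves little time for the forcing to change
  the energy, and for small \<epsilon> it forces the turning level close to \<open>- R\<close>. The
  energy is then nearly that of the saddles \<open>- R\<close> and \<open>R\<close>, which share one
  energy level because the forcing vanishes at \<pi>/2. Such an orbit passes above or below the
  origin with kinetic energy bounded away from 0, so the angle is strictly increasing after the turn
  and its final value determines the number of extrema. The accuracy \<eta> of the asymptotics fixes
  \<delta>, and \<delta> fixes the bound on \<epsilon>. Hence each \<eta> comes with its own
  solutions, whereas the limits speak of one family; a near-optimal choice at each \<epsilon>
  reconciles the two.\<close>

lemma integral_has_real_derivative_atLeast:
  fixes \<phi> :: "real \<Rightarrow> real"
  assumes "continuous_on {0..} \<phi>" and "0 \<le> t"
  shows "((\<lambda>x. integral {0..x} \<phi>) has_real_derivative \<phi> t) (at t within {0..})"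
proof -
  have "((\<lambda>x. integral {0..x} \<phi>) has_real_derivative \<phi> t) (at t within {0..t+1})"
    using assms by (intro integral_has_real_derivative continuous_on_subset[OF assms(1)]) auto
  moreover have "at t within {0..t+1} = at t within {0..}"
    by (rule at_within_nhd[where S="{..<t+1}"]) auto
  ultimately show ?thesis by simp
qed

text \<open>Takes the upper limit out of the integrand, so that the double primitive of
  \<open>\<phi>\<close> can be differentiated by the fundamental theorem alone.\<close>

lemma integral_kernel_split:
  fixes \<phi> :: "real \<Rightarrow> real"
  assumes "continuous_on {0..} \<phi>"
  shows "integral {0..x} (\<lambda>s. (x - s) * \<phi> s) = x * integral {0..x} \<phi> - integral {0..x} (\<lambda>s. s * \<phi> s)"
proof -
  have c: "continuous_on {0..x} \<phi>" using assms by (rule continuous_on_subset) auto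
  have "integral {0..x} (\<lambda>s. x * \<phi> s - s * \<phi> s) =
      integral {0..x} (\<lambda>s. x * \<phi> s) - integral {0..x} (\<lambda>s. s * \<phi> s)"
    by (rule integral_diff) (auto intro!: integrable_continuous_interval continuous_intros c)
  then show ?thesis by (simp add: algebra_simps)
qed

lemma integral_kernel_deriv:
  fixes \<phi> :: "real \<Rightarrow> real"
  assumes c: "continuous_on {0..} \<phi>" and t: "0 \<le> t"
  shows "((\<lambda>x. integral {0..x} (\<lambda>s. (x - s) * \<phi> s)) has_real_derivative integral {0..t} \<phi>) (at t within {0..})"
proof -
  have d: "((\<lambda>x. integral {0..x} (\<lambda>s. s * \<phi> s)) has_real_derivative t * \<phi> t) (at t within {0..})"
    by (rule integral_has_real_derivative_atLeast[OF _ t]) (intro continuous_intros c)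
  show ?thesis
    unfolding integral_kernel_split[OF c]
    by (rule derivative_eq_intros integral_has_real_derivative_atLeast[OF c t] d refl | simp)+
qed

text \<open>The source of the contraction: in the weight \<open>exp (k * x)\<close>, integrating
  twice gains a factor \<open>1 / k\<^sup>2\<close>.\<close>

lemma integral_kernel_exp_le:
  fixes k :: real
  assumes k: "k > 0" and x: "0 \<le> x"
  shows "integral {0..x} (\<lambda>s. (x - s) * exp (k * s)) \<le> exp (k * x) / k\<^sup>2"
proof -
  have "((\<lambda>s. (x - s) * exp (k * s)) has_integral
      ((x - x) / k + 1 / k\<^sup>2) * exp (k * x) - ((x - 0) / k + 1 / k\<^sup>2) * exp (k * 0)) {0..x}"
  proof (rule fundamental_theorem_of_calculus[OF x])
    fix s assume "s \<in> {0..x}"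
    show "((\<lambda>s. ((x - s) / k + 1 / k\<^sup>2) * exp (k * s)) has_vector_derivative (x - s) * exp (k * s)) (at s within {0..x})"
      unfolding has_real_derivative_iff_has_vector_derivative[symmetric]
      using k by (auto intro!: derivative_eq_intros simp: field_simps power2_eq_square)
  qed
  then have "integral {0..x} (\<lambda>s. (x - s) * exp (k * s)) = exp (k * x) / k\<^sup>2 - (x / k + 1 / k\<^sup>2)"
    using k by (simp add: integral_unique)
  moreover have "0 \<le> x / k + 1 / k\<^sup>2" using k x by simp
  ultimately show ?thesis by simp
qed

lemma integral_kernel_bound:
  fixes \<phi> :: "real \<Rightarrow> real"
  assumes c: "continuous_on {0..} \<phi>" and k: "k > 0" and x: "0 \<le> x"
    and bd: "\<And>s. 0 \<le> s \<Longrightarrow> s \<le> x \<Longrightarrow> \<bar>\<phi> s\<bar> \<le> C * exp (k * s)"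
  shows "\<bar>integral {0..x} (\<lambda>s. (x - s) * \<phi> s)\<bar> \<le> C * exp (k * x) / k\<^sup>2"
proof -
  have C: "0 \<le> C" using bd[of 0] x by simp
  have "norm (integral {0..x} (\<lambda>s. (x - s) * \<phi> s)) \<le> integral {0..x} (\<lambda>s. C * ((x - s) * exp (k * s)))"
  proof (rule integral_norm_bound_integral)
    show "(\<lambda>s. (x - s) * \<phi> s) integrable_on {0..x}"
      by (intro integrable_continuous_interval continuous_intros continuous_on_subset[OF c]) auto
    show "(\<lambda>s. C * ((x - s) * exp (k * s))) integrable_on {0..x}"
      by (intro integrable_continuous_interval continuous_intros)
    fix s assume s: "s \<in> {0..x}"
    then have "(x - s) * \<bar>\<phi> s\<bar> \<le> (x - s) * (C * exp (k * s))"
      using bd[of s] by (intro mult_left_mono) auto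
    then show "norm ((x - s) * \<phi> s) \<le> C * ((x - s) * exp (k * s))"
      using s by (simp add: abs_mult mult_ac)
  qed
  also have "\<dots> = C * integral {0..x} (\<lambda>s. (x - s) * exp (k * s))" by simp
  also have "\<dots> \<le> C * (exp (k * x) / k\<^sup>2)"
    using integral_kernel_exp_le[OF k x] C by (rule mult_left_mono)
  finally show ?thesis by simp
qed

text \<open>The existence proof is Banach's fixed point theorem for the weighted unknown
  \<open>w t = exp (- k t) v t\<close>, which makes the integral operator a contraction on the whole half line.\<close>

proposition second_order_ivp_family:
  fixes G :: "real \<Rightarrow> real \<Rightarrow> real"
  assumes contG: "continuous_on UNIV (\<lambda>(t, x). G t x)"
    and bdd: "\<And>t x. \<bar>G t x\<bar> \<le> B"
    and lip: "\<And>t x y. \<bar>G t x - G t y\<bar> \<le> K * \<bar>x - y\<bar>"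
  obtains v q where
    "\<And>b. v b 0 = b"
    "\<And>b. q b 0 = G 0 b"
    "\<And>b t. 0 \<le> t \<Longrightarrow> (v b has_real_derivative t * q b t) (at t within {0..})"
    "\<And>b t. 0 \<le> t \<Longrightarrow> ((\<lambda>t. t * q b t) has_real_derivative G t (v b t)) (at t within {0..})"
    "continuous_on (UNIV \<times> {0..}) (\<lambda>(b, t). v b t)"
    "continuous_on (UNIV \<times> {0..}) (\<lambda>(b, t). q b t)"
proof -
  have K0: "K \<ge> 0" using lip[of 0 0 1] by simp
  have B0: "B \<ge> 0" using bdd[of 0 0] by linarith
  \<comment> \<open>With this weight the contraction factor \<open>K / k\<^sup>2\<close> is at most
    1/2; the summand 1 keeps \<open>k\<close> positive when \<open>K = 0\<close>.\<close>
  define k where "k = sqrt (2 * K + 1)"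
  have k0: "k > 0" and k2: "k\<^sup>2 = 2 * K + 1" using K0 by (auto simp: k_def)
  have Gc: "continuous_on S (\<lambda>s. G (f s) (g s))" if "continuous_on S f" "continuous_on S g"
    for S :: "'z::topological_space set" and f g
    using continuous_on_compose2[OF contG, of S "\<lambda>s. (f s, g s)"] that
    by (auto intro!: continuous_intros)
  define \<Phi> where "\<Phi> = (\<lambda>b (w :: real \<Rightarrow>\<^sub>C real) x.
     b + integral {0..x} (\<lambda>s. (x - s) * G s (exp (k * s) * w s)))"
  \<comment> \<open>The type of bounded continuous functions lives on the whole line, so the
    operator is continued to negative times by its value at 0.\<close>
  define F where "F = (\<lambda>b w x. exp (- k * max 0 x) * \<Phi> b w (max 0 x))"
  have gc: "continuous_on S (\<lambda>s. G s (exp (k * s) * apply_bcontfun w s))" for S w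
    by (intro Gc continuous_intros) auto
  have bex: "B \<le> B * exp (k * s)" if "0 \<le> s" for s
    using B0 k0 that by (simp add: mult_le_cancel_left1)
  have \<Phi>c: "continuous_on {0..} (\<Phi> b w)" for b w
    unfolding \<Phi>_def continuous_on_eq_continuous_within
    by (auto intro!: continuous_intros DERIV_continuous[OF integral_kernel_deriv[OF gc]])
  have Fb: "F b w \<in> bcontfun" for b w
  proof (rule bcontfun_normI)
    show "continuous_on UNIV (F b w)" unfolding F_def
      by (intro continuous_intros continuous_on_compose2[OF \<Phi>c[of b w]]) (auto simp: le_max_iff_disj)
    fix x :: real
    define y where "y = max 0 x"
    have y: "0 \<le> y" by (simp add: y_def le_max_iff_disj)
    have "\<bar>integral {0..y} (\<lambda>s. (y - s) * G s (exp (k * s) * w s))\<bar> \<le> B * exp (k * y) / k\<^sup>2"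
      using bex by (intro integral_kernel_bound gc k0 y order_trans[OF bdd]) auto
    then have "\<bar>\<Phi> b w y\<bar> \<le> \<bar>b\<bar> + B * exp (k * y) / k\<^sup>2" unfolding \<Phi>_def by linarith
    also have "\<bar>b\<bar> \<le> \<bar>b\<bar> * exp (k * y)" using k0 y by (simp add: mult_le_cancel_left1)
    finally have "\<bar>\<Phi> b w y\<bar> \<le> (\<bar>b\<bar> + B / k\<^sup>2) * exp (k * y)" by (simp add: algebra_simps)
    then have "exp (- k * y) * \<bar>\<Phi> b w y\<bar> \<le> exp (- k * y) * ((\<bar>b\<bar> + B / k\<^sup>2) * exp (k * y))"
      by (intro mult_left_mono) auto
    also have "\<dots> = \<bar>b\<bar> + B / k\<^sup>2" by (simp add: exp_minus)
    finally show "norm (F b w x) \<le> \<bar>b\<bar> + B / k\<^sup>2" by (simp add: F_def y_def abs_mult)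
  qed
  define T where "T = (\<lambda>b w. Bcontfun (F b w))"
  have Tap: "apply_bcontfun (T b w) = F b w" for b w
    unfolding T_def using Fb by (simp add: Bcontfun_inverse)
  \<comment> \<open>Varying \<open>b\<close> together with \<open>w\<close> gives the contraction
    for fixed \<open>b\<close> and also, applied to two fixed points, their Lipschitz dependence on
    \<open>b\<close>.\<close>
  have contr: "dist (T b w) (T b' w') \<le> \<bar>b - b'\<bar> + (1/2) * dist w w'" for b b' w w'
  proof (rule dist_bound)
    fix x :: real
    define y where "y = max 0 x"
    define \<phi> where "\<phi> = (\<lambda>s. G s (exp (k * s) * w s) - G s (exp (k * s) * w' s))"
    have y: "0 \<le> y" by (simp add: y_def le_max_iff_disj)
    have i: "(\<lambda>s. (y - s) * G s (exp (k * s) * apply_bcontfun w s)) integrable_on {0..y}" for w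
      by (intro integrable_continuous_interval continuous_intros gc)
    have "\<Phi> b w y - \<Phi> b' w' y = b - b' + integral {0..y} (\<lambda>s. (y - s) * \<phi> s)"
      unfolding \<Phi>_def \<phi>_def right_diff_distrib
      by (subst integral_diff) (use i in \<open>auto simp: right_diff_distrib\<close>)
    moreover have "\<bar>integral {0..y} (\<lambda>s. (y - s) * \<phi> s)\<bar> \<le> (K * dist w w') * exp (k * y) / k\<^sup>2"
    proof (rule integral_kernel_bound[OF _ k0 y])
      show "continuous_on {0..} \<phi>" unfolding \<phi>_def by (intro continuous_intros gc)
      fix s :: real assume "0 \<le> s"
      have "\<bar>\<phi> s\<bar> \<le> K * \<bar>exp (k * s) * w s - exp (k * s) * w' s\<bar>"
        unfolding \<phi>_def by (rule lip)
      also have "\<dots> = K * (exp (k * s) * dist (w s) (w' s))"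
        by (simp add: dist_real_def abs_mult flip: right_diff_distrib)
      also have "\<dots> \<le> K * (exp (k * s) * dist w w')"
        using K0 by (intro mult_left_mono dist_bounded) auto
      finally show "\<bar>\<phi> s\<bar> \<le> K * dist w w' * exp (k * s)" by (simp add: mult_ac)
    qed
    moreover have "(K * dist w w') * exp (k * y) / k\<^sup>2 \<le> (1/2) * dist w w' * exp (k * y)"
    proof -
      have "K / k\<^sup>2 \<le> 1/2" using K0 by (simp add: k2 field_simps)
      then have "K / k\<^sup>2 * (dist w w' * exp (k * y)) \<le> 1/2 * (dist w w' * exp (k * y))"
        by (intro mult_right_mono) auto
      then show ?thesis by (simp add: mult_ac)
    qed
    ultimately have "\<bar>\<Phi> b w y - \<Phi> b' w' y\<bar> \<le> \<bar>b - b'\<bar> + (1/2) * dist w w' * exp (k * y)"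
      by linarith
    also have "\<bar>b - b'\<bar> \<le> \<bar>b - b'\<bar> * exp (k * y)" using k0 y by (simp add: mult_le_cancel_left1)
    finally have "\<bar>\<Phi> b w y - \<Phi> b' w' y\<bar> \<le> (\<bar>b - b'\<bar> + (1/2) * dist w w') * exp (k * y)"
      by (simp add: algebra_simps)
    then have "exp (- k * y) * \<bar>\<Phi> b w y - \<Phi> b' w' y\<bar> \<le>
        exp (- k * y) * ((\<bar>b - b'\<bar> + (1/2) * dist w w') * exp (k * y))"
      by (intro mult_left_mono) auto
    also have "\<dots> = \<bar>b - b'\<bar> + (1/2) * dist w w'" by (simp add: exp_minus)
    finally show "dist (T b w x) (T b' w' x) \<le> \<bar>b - b'\<bar> + (1/2) * dist w w'"
      unfolding Tap F_def y_def dist_real_def by (simp add: abs_mult flip: right_diff_distrib)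
  qed
  have "\<exists>!w. T b w = w" for b
    by (rule banach_fix_type[where c="1/2"]) (use contr[of b _ b] in auto)
  then obtain W where W: "\<And>b. T b (W b) = W b" by metis
  have Wl: "dist (W b) (W b') \<le> 2 * \<bar>b - b'\<bar>" for b b'
    using contr[of b "W b" b' "W b'"] by (simp add: W)
  have Wc: "continuous_on UNIV (\<lambda>(b, x). apply_bcontfun (W b) x)"
  proof (rule continuous_at_imp_continuous_on, clarify)
    fix b x
    show "isCont (\<lambda>(b, x). apply_bcontfun (W b) x) (b, x)"
      unfolding continuous_at_eps_delta
    proof (intro allI impI)
      fix e :: real assume e: "e > 0"
      have "isCont (apply_bcontfun (W b)) x"
        using continuous_on_apply_bcontfun[of UNIV "W b"] by (metis UNIV_I continuous_on_eq_continuous_at open_UNIV)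
      then obtain d where d: "d > 0" "\<And>y. dist y x < d \<Longrightarrow> dist (W b y) (W b x) < e / 2"
        unfolding continuous_at_eps_delta using e by (metis half_gt_zero)
      show "\<exists>d>0. \<forall>x'. dist x' (b, x) < d \<longrightarrow>
          dist (case x' of (b, x) \<Rightarrow> apply_bcontfun (W b) x) (case (b, x) of (b, x) \<Rightarrow> apply_bcontfun (W b) x) < e"
      proof (intro exI[of _ "min d (e / 4)"] conjI allI impI, goal_cases)
        case (2 z)
        obtain b' y where z: "z = (b', y)" by (cases z)
        have 1: "dist b' b < e / 4" "dist y x < d"
          using 2 dist_fst_le[of z "(b,x)"] dist_snd_le[of z "(b,x)"] by (auto simp: z)
        have "dist (W b' y) (W b y) \<le> 2 * dist b' b"
          using dist_bounded[of "W b'" y "W b"] Wl[of b' b] by (simp add: dist_real_def)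
        then have "dist (W b' y) (W b x) < e"
          using 1 d(2)[of y] dist_triangle[of "W b' y" "W b x" "W b y"] by linarith
        then show ?case by (simp add: z)
      qed (use d e in auto)
    qed
  qed
  define v where "v = (\<lambda>b x. exp (k * x) * W b x)"
  have vc: "continuous_on S (\<lambda>s. v (f s) (g s))" if "continuous_on S f" "continuous_on S g"
    for S :: "'z::topological_space set" and f g
    unfolding v_def
    using continuous_on_compose2[OF Wc, of S "\<lambda>s. (f s, g s)"] that
    by (auto intro!: continuous_intros)
  have hc: "continuous_on S (\<lambda>s. G s (v b s))" for S b
    by (intro Gc vc continuous_intros)
  have v_eq: "v b x = b + integral {0..x} (\<lambda>s. (x - s) * G s (v b s))" if x: "0 \<le> x" for b x
  proof -
    have "W b x = exp (- k * x) * \<Phi> b (W b) x"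
      using Tap[of b "W b"] x by (simp add: W F_def max_def)
    then show ?thesis unfolding v_def \<Phi>_def by (simp add: exp_minus field_simps)
  qed
  \<comment> \<open>The substitution \<open>s = x * r\<close> turns \<open>v' / x\<close> into an
    average of the force, which has no singularity at \<open>x = 0\<close>.\<close>
  define q where "q = (\<lambda>b x. integral (cbox 0 1) (\<lambda>r. G (x * r) (v b (x * r))))"
  have q_eq: "integral {0..x} (\<lambda>s. G s (v b s)) = x * q b x" if x: "0 \<le> x" for b x
  proof (cases "x = 0")
    case False
    then have x: "x > 0" using x by simp
    have "((\<lambda>s. G s (v b s)) has_integral integral {0..x} (\<lambda>s. G s (v b s))) {0..x}"
      by (intro integrable_integral integrable_continuous_interval hc)
    then have "((\<lambda>r. G (x *\<^sub>R r + 0) (v b (x *\<^sub>R r + 0))) has_integral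
        (1 / \<bar>x\<bar> ^ DIM(real)) *\<^sub>R integral {0..x} (\<lambda>s. G s (v b s))) ((\<lambda>r. (1 / x) *\<^sub>R r + -((1 / x) *\<^sub>R 0)) ` cbox 0 x)"
      using x by (intro has_integral_affinity) auto
    moreover have "(\<lambda>r. (1 / x) *\<^sub>R r + -((1 / x) *\<^sub>R 0)) ` cbox 0 x = cbox 0 (1::real)"
      using x by (auto simp: image_def field_simps zero_le_mult_iff intro!: bexI[of _ "x * _"])
    ultimately have "q b x = (1 / x) * integral {0..x} (\<lambda>s. G s (v b s))"
      unfolding q_def using x by (simp add: integral_unique)
    then show ?thesis using x by simp
  qed (simp add: q_def)
  show ?thesis
  proof
    fix b show "v b 0 = b" using v_eq[of 0 b] by simp
    then show "q b 0 = G 0 b" by (simp add: q_def)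
  next
    fix b t :: real assume t: "0 \<le> t"
    have "((\<lambda>x. b + integral {0..x} (\<lambda>s. (x - s) * G s (v b s))) has_real_derivative
       t * q b t) (at t within {0..})"
      using integral_kernel_deriv[OF hc t, of b] q_eq[OF t, of b] by (auto intro!: derivative_eq_intros)
    then show "(v b has_real_derivative t * q b t) (at t within {0..})"
      by (rule has_field_derivative_transform_within[where d=1]) (use t in \<open>auto simp: v_eq\<close>)
    show "((\<lambda>t. t * q b t) has_real_derivative G t (v b t)) (at t within {0..})"
      using integral_has_real_derivative_atLeast[OF hc t, of b]
      by (rule has_field_derivative_transform_within[where d=1]) (use t in \<open>auto simp: q_eq\<close>)
  next
    show "continuous_on (UNIV \<times> {0..}) (\<lambda>(b, t). v b t)"
      unfolding case_prod_unfold by (intro vc continuous_intros)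
    have "continuous_on (UNIV \<times> cbox 0 1) (\<lambda>(z, r). G (snd z * r) (v (fst z) (snd z * r)))"
      unfolding case_prod_unfold by (intro Gc vc continuous_intros)
    then have "continuous_on UNIV (\<lambda>z. q (fst z) (snd z))"
      unfolding q_def by (rule integral_continuous_on_param)
    then show "continuous_on (UNIV \<times> {0..}) (\<lambda>(b, t). q b t)"
      unfolding case_prod_unfold by (rule continuous_on_subset) simp
  qed
qed

lemma MVT_DERIV:
  fixes f :: "real \<Rightarrow> real"
  assumes "a < b" "continuous_on {a..b} f" "\<And>x. a < x \<Longrightarrow> x < b \<Longrightarrow> DERIV f x :> f' x"
  obtains z where "a < z" "z < b" "f b - f a = (b - a) * f' z"
  using MVT[OF assms(1,2)] assms(3) by (metis DERIV_unique real_differentiable_def)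

section \<open>The cubic\<close>

locale supercritical =
  fixes lam :: real
  assumes lam: "lam > 3 / 2 powr (2 / 3)"
begin

definition h :: "real \<Rightarrow> real" where "h x = x ^ 3 - lam * x"
text \<open>The zeros of \<open>h\<close> are \<open>- R\<close>, \<open>0\<close> and
  \<open>R\<close>, the equilibria when the forcing vanishes; its critical points are
  \<open>- a\<close> and \<open>a\<close>.\<close>

definition R :: real where "R = sqrt lam"
definition a :: real where "a = sqrt (lam / 3)"
definition U0 :: real where "U0 = U_lower lam pi"

lemma lam_pos: "lam > 0"
  using lam by (smt (verit) divide_pos_pos powr_gt_zero)

lemma R_pos: "R > 0" and R_sq: "R\<^sup>2 = lam" and R_mult: "R * R = lam"
  using lam_pos by (auto simp: R_def)

lemma a_pos: "a > 0" and a_sq: "3 * a\<^sup>2 = lam" and a_less_R: "a < R"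
  using lam_pos by (auto simp: a_def R_def)

text \<open>The local maximum of \<open>h\<close> is \<open>2 * a ^ 3\<close>, with square
  \<open>4 * lam ^ 3 / 27\<close>; the threshold is the value of \<open>lam\<close> for which this
  equals 1.\<close>

lemma h_neg_a: "h (- a) > 1"
proof -
  have p: "((2::real) powr (2 / 3)) ^ 3 = 4" by (simp add: powr_power)
  have "(3 / 2 powr (2 / 3)) ^ 3 < lam ^ 3"
    using lam by (intro power_strict_mono) auto
  then have "27 / 4 < lam ^ 3" by (simp add: power_divide p)
  then have "27 / 4 < (3 * a\<^sup>2) ^ 3" by (simp add: a_sq)
  then have "1 / 4 < a ^ 6" by (simp add: power_mult_distrib flip: power_mult)
  then have "(1 / 2) ^ 2 < (a ^ 3) ^ 2" by (simp add: power_divide flip: power_mult)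
  then have a3: "1 / 2 < a ^ 3" using a_pos by (meson power_less_imp_less_base less_imp_le zero_less_power)
  have "h (- a) = - (a ^ 3) + (3 * a\<^sup>2) * a" by (simp add: h_def a_sq power3_eq_cube)
  also have "\<dots> = 2 * a ^ 3" by (simp add: power2_eq_square power3_eq_cube)
  finally have "h (- a) = 2 * a ^ 3" .
  then show ?thesis using a3 by simp
qed

lemma h_R: "h R = 0" "h (- R) = 0"
  by (simp_all add: h_def power3_eq_cube R_mult)

lemma h_diff: "h y - h x = (y - x) * (x\<^sup>2 + x * y + y\<^sup>2 - lam)"
  by (simp add: h_def power2_eq_square power3_eq_cube algebra_simps)

lemma h_strict_mono: "x < y \<Longrightarrow> y \<le> - a \<Longrightarrow> h x < h y"
proof -
  assume "x < y" "y \<le> - a"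
  then have "a * a < x * x" "a * a \<le> x * y" "a * a \<le> y * y"
    using a_pos mult_strict_mono[of a "- x" a "- x"] mult_mono[of a "- x" a "- y"] mult_mono[of a "- y" a "- y"]
    by auto
  then have "x\<^sup>2 + x * y + y\<^sup>2 - lam > 0" using a_sq by (simp add: power2_eq_square)
  then show "h x < h y" using h_diff[of y x] \<open>x < y\<close> by (smt (verit) mult_pos_pos)
qed

lemma h_mono: "x \<le> y \<Longrightarrow> y \<le> - a \<Longrightarrow> h x \<le> h y"
  using h_strict_mono[of x y] by (cases "x = y") auto

lemma abs_le_R: "\<bar>x\<bar> \<le> R \<Longrightarrow> x\<^sup>2 \<le> lam"
  using abs_le_square_iff[of x R] R_pos by (simp add: R_sq)

lemma abs_less_R: "\<bar>x\<bar> < R \<Longrightarrow> x\<^sup>2 < lam"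
  using power_strict_mono[of "\<bar>x\<bar>" R 2] by (simp add: R_sq)

lemma h_lipschitz: "\<bar>x\<bar> \<le> R \<Longrightarrow> \<bar>y\<bar> \<le> R \<Longrightarrow> \<bar>h x - h y\<bar> \<le> 4 * lam * \<bar>x - y\<bar>"
proof -
  assume *: "\<bar>x\<bar> \<le> R" "\<bar>y\<bar> \<le> R"
  then have "\<bar>y * x\<bar> \<le> R * R" unfolding abs_mult by (intro mult_mono) auto
  then have "\<bar>y\<^sup>2 + y * x + x\<^sup>2 - lam\<bar> \<le> 4 * lam"
    using abs_le_R[OF *(1)] abs_le_R[OF *(2)] lam_pos zero_le_power2[of x] zero_le_power2[of y]
    unfolding R_mult abs_le_iff by linarith
  then show ?thesis
    unfolding h_diff abs_mult by (simp add: mult.commute mult_left_mono)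
qed

text \<open>On \<open>[- R, - a]\<close> the cubic rises from 0 to a value above 1, and it is
  strictly increasing everywhere below \<open>- a\<close>, so the root found there is the smallest
  one.\<close>

lemma U0: "- R < U0" "U0 < - a" "h U0 = 1"
proof -
  have "continuous_on {-R..-a} h" unfolding h_def by (intro continuous_intros)
  then obtain z where z: "- R \<le> z" "z \<le> - a" "h z = 1"
    using IVT'[of h "- R" 1 "- a"] h_R h_neg_a a_less_R by force
  have fin: "finite (cubic_roots lam pi)"
    using cubic_roots_three[OF lam, of pi] by (metis finite.emptyI finite_insert)
  have "U0 = z" unfolding U0_def U_lower_def
  proof (rule Min_eqI[OF fin])
    show "z \<in> cubic_roots lam pi" using z by (simp add: cubic_roots_def h_def)
    fix y assume "y \<in> cubic_roots lam pi"
    then have "h y = 1" by (simp add: cubic_roots_def h_def)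
    then show "z \<le> y" using h_strict_mono[of y z] z by force
  qed
  moreover have "z \<noteq> - R" "z \<noteq> - a" using z h_R h_neg_a by auto
  ultimately show "- R < U0" "U0 < - a" "h U0 = 1" using z by auto
qed

lemma U_half_pi: "U_lower lam (pi / 2) = - R" "U_upper lam (pi / 2) = R"
proof -
  have "x ^ 3 - lam * x = x * ((x - R) * (x + R))" for x
    using R_mult by (simp add: power3_eq_cube algebra_simps)
  then have "cubic_roots lam (pi / 2) = {- R, 0, R}"
    by (auto simp: cubic_roots_def)
  then show "U_lower lam (pi / 2) = - R" "U_upper lam (pi / 2) = R"
    using R_pos by (auto simp: U_lower_def U_upper_def)
qed

lemma h_DERIV: "DERIV h x :> 3 * x\<^sup>2 - lam"
  unfolding h_def by (auto intro!: derivative_eq_intros)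

section \<open>Truncation of the cubic to a bounded, globally Lipschitz force\<close>

definition cl :: "real \<Rightarrow> real" where "cl x = max (- R) (min R x)"

lemma cl_abs: "\<bar>cl x\<bar> \<le> R" using R_pos by (auto simp: cl_def)

lemma cl_id: "\<bar>x\<bar> \<le> R \<Longrightarrow> cl x = x" by (auto simp: cl_def)

lemma cl_low: "x \<le> - R \<Longrightarrow> cl x = - R" using R_pos by (auto simp: cl_def)

lemma cl_lipschitz: "\<bar>cl x - cl y\<bar> \<le> \<bar>x - y\<bar>" by (auto simp: cl_def)

text \<open>The minus sign comes from reversing time: cos (\<pi> - t) = - cos t.\<close>

definition force :: "real \<Rightarrow> real \<Rightarrow> real" where "force x t = h (cl x) - cos t"

lemma force_lipschitz: "\<bar>force x t - force y t\<bar> \<le> 4 * lam * \<bar>x - y\<bar>"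
proof -
  have "\<bar>force x t - force y t\<bar> \<le> 4 * lam * \<bar>cl x - cl y\<bar>"
    using h_lipschitz[OF cl_abs cl_abs, of x y] by (simp add: force_def)
  also have "\<dots> \<le> 4 * lam * \<bar>x - y\<bar>" using cl_lipschitz lam_pos by (intro mult_left_mono) auto
  finally show ?thesis .
qed

lemma force_bounded: "\<bar>force x t\<bar> \<le> 4 * lam * R + 1"
proof -
  have "\<bar>h (cl x) - h 0\<bar> \<le> 4 * lam * \<bar>cl x - 0\<bar>" by (rule h_lipschitz) (use cl_abs R_pos in auto)
  also have "\<dots> \<le> 4 * lam * R" using cl_abs lam_pos by (intro mult_left_mono) auto
  finally have "\<bar>h (cl x)\<bar> \<le> 4 * lam * R" by (simp add: h_def)
  moreover have "\<bar>cos t\<bar> \<le> 1" by simp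
  ultimately show ?thesis unfolding force_def by linarith
qed

lemma force_low: "x \<le> - R \<Longrightarrow> force x t = - cos t"
  by (simp add: force_def cl_low h_R)

lemma force_id: "\<bar>x\<bar> \<le> R \<Longrightarrow> force x t = h x - cos t"
  by (simp add: force_def cl_id)

lemma continuous_on_force: "continuous_on UNIV (\<lambda>(t, x). force x t)"
  unfolding force_def cl_def h_def case_prod_unfold by (intro continuous_intros)

end

section \<open>Shooting backwards from the right end point\<close>

text \<open>\<open>v b\<close> is the solution in the reversed time \<open>\<tau> = \<pi> - t\<close> with \<open>v = b\<close> and \<open>v' = 0\<close> at \<open>\<tau> = 0\<close>.
  Its derivative is \<open>\<tau> * q b \<tau>\<close>: unlike \<open>v'\<close>, the quotient \<open>q\<close> keeps a sign at \<open>\<tau> = 0\<close>.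
  The cubic is frozen outside \<open>[-R, R]\<close> so that all solutions are global.\<close>

locale shooting = supercritical +
  fixes ep :: real and v q :: "real \<Rightarrow> real \<Rightarrow> real"
  assumes ep: "ep > 0"
    and v_0: "v b 0 = b"
    and q_0: "q b 0 = force b 0 / ep\<^sup>2"
    and v_deriv: "0 \<le> t \<Longrightarrow> (v b has_real_derivative t * q b t) (at t within {0..})"
    and p_deriv: "0 \<le> t \<Longrightarrow> ((\<lambda>t. t * q b t) has_real_derivative force (v b t) t / ep\<^sup>2) (at t within {0..})"
    and v_cont: "continuous_on (UNIV \<times> {0..}) (\<lambda>(b, t). v b t)"
    and q_cont: "continuous_on (UNIV \<times> {0..}) (\<lambda>(b, t). q b t)"

lemma (in supercritical) shooting_exists:
  assumes ep: "ep > 0"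
  obtains v q where "shooting lam ep v q"
proof -
  have e2: "ep\<^sup>2 > 0" using ep by simp
  have 1: "continuous_on UNIV (\<lambda>(t, x). force x t / ep\<^sup>2)"
    using continuous_on_force ep unfolding case_prod_unfold by (intro continuous_intros) auto
  have 2: "\<bar>force x t / ep\<^sup>2\<bar> \<le> (4 * lam * R + 1) / ep\<^sup>2" for t x
    using force_bounded[of x t] e2 by (simp add: abs_divide divide_right_mono)
  have 3: "\<bar>force x t / ep\<^sup>2 - force y t / ep\<^sup>2\<bar> \<le> 4 * lam / ep\<^sup>2 * \<bar>x - y\<bar>" for t x y
    using force_lipschitz[of x t y] e2 by (simp add: abs_divide divide_right_mono flip: diff_divide_distrib)
  obtain v q where
    "\<And>b. v b 0 = b"
    "\<And>b. q b 0 = force b 0 / ep\<^sup>2"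
    "\<And>b t. 0 \<le> t \<Longrightarrow> (v b has_real_derivative t * q b t) (at t within {0..})"
    "\<And>b t. 0 \<le> t \<Longrightarrow> ((\<lambda>t. t * q b t) has_real_derivative force (v b t) t / ep\<^sup>2) (at t within {0..})"
    "continuous_on (UNIV \<times> {0..}) (\<lambda>(b, t). v b t)"
    "continuous_on (UNIV \<times> {0..}) (\<lambda>(b, t). q b t)"
    by (rule second_order_ivp_family[OF 1 2 3]) blast
  then have "shooting lam ep v q" using ep by unfold_locales auto
  then show ?thesis by (rule that)
qed

context shooting
begin

definition p :: "real \<Rightarrow> real \<Rightarrow> real" where "p b t = t * q b t"

lemma p_0: "p b 0 = 0" by (simp add: p_def)

lemma at_within_pos: "0 < t \<Longrightarrow> at t within {0..} = at (t::real)"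
  by (rule at_within_interior) simp

lemma v_DERIV: "0 < t \<Longrightarrow> DERIV (v b) t :> p b t"
  using v_deriv[of t b] by (simp add: p_def at_within_pos)

lemma p_DERIV: "0 < t \<Longrightarrow> DERIV (p b) t :> force (v b t) t / ep\<^sup>2"
  using p_deriv[of t b] by (simp add: p_def[abs_def] at_within_pos)

lemma v_cont_on: "S \<subseteq> {0..} \<Longrightarrow> continuous_on S (v b)"
  by (rule continuous_on_subset[OF DERIV_continuous_on[of "{0..}" _ "\<lambda>t. t * q b t"]]) (use v_deriv in auto)

lemma p_cont_on: "S \<subseteq> {0..} \<Longrightarrow> continuous_on S (p b)"
  unfolding p_def[abs_def]
  by (rule continuous_on_subset[OF DERIV_continuous_on[of "{0..}" _ "\<lambda>t. force (v b t) t / ep\<^sup>2"]])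
    (use p_deriv in auto)

lemma v_antimono:
  assumes "\<And>x. s < x \<Longrightarrow> x < t \<Longrightarrow> p b x \<le> 0" "0 \<le> s" "s \<le> t"
  shows "v b t \<le> v b s"
proof (rule DERIV_nonpos_imp_decreasing_open[OF assms(3)])
  show "\<exists>y. DERIV (v b) x :> y \<and> y \<le> 0" if "s < x" "x < t" for x
    using assms(1)[OF that] v_DERIV[of x b] that assms(2) by auto
qed (use assms in \<open>auto intro!: v_cont_on\<close>)

lemma v_strict_antimono:
  assumes "\<And>x. s < x \<Longrightarrow> x < t \<Longrightarrow> p b x < 0" "0 \<le> s" "s < t"
  shows "v b t < v b s"
proof (rule DERIV_neg_imp_decreasing_open[OF assms(3)])
  show "\<exists>y. DERIV (v b) x :> y \<and> y < 0" if "s < x" "x < t" for x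
    using assms(1)[OF that] v_DERIV[of x b] that assms(2) by auto
qed (use assms in \<open>auto intro!: v_cont_on\<close>)

text \<open>At a degenerate turning point \<open>p\<close> would vanish together with \<open>p'\<close>; then \<open>\<epsilon>\<^sup>2 p'' = sin t > 0\<close>,
  so that \<open>p\<close> would have been positive just before.\<close>

lemma turn_nondegenerate:
  assumes b: "b \<le> U0" and t: "0 < t" "t < pi / 2"
    and np: "\<And>s. 0 \<le> s \<Longrightarrow> s \<le> t \<Longrightarrow> p b s \<le> 0" and pt: "p b t = 0"
  shows "- R < v b t" "force (v b t) t > 0"
proof -
  have e2: "ep\<^sup>2 > 0" using ep by simp
  have ge: "force (v b t) t \<ge> 0"
  proof (rule ccontr)
    assume "\<not> ?thesis"
    then have "force (v b t) t / ep\<^sup>2 < 0" using e2 by (simp add: divide_neg_pos)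
    from DERIV_neg_dec_left[OF p_DERIV[OF t(1)] this] obtain d
      where d: "d > 0" "\<And>x. 0 < x \<Longrightarrow> x < d \<Longrightarrow> p b t < p b (t - x)" by blast
    define x where "x = min d t / 2"
    have "p b (t - x) > 0" using d(2)[of x] pt d(1) t by (auto simp: x_def)
    then show False using np[of "t - x"] d t by (auto simp: x_def min_def split: if_splits)
  qed
  have cp: "cos t > 0" using t by (intro cos_gt_zero_pi) auto
  \<comment> \<open>At or below \<open>- R\<close> the truncated force is \<open>- cos t\<close>,
    which is negative before \<pi>/2.\<close>
  show low: "- R < v b t"
    using ge cp force_low[of "v b t" t] by force
  have "v b t \<le> v b 0" using np t by (intro v_antimono) auto
  then have up: "v b t < R" using b U0 R_pos a_pos by (simp add: v_0)
  show "force (v b t) t > 0"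
  proof (rule ccontr)
    assume "\<not> ?thesis"
    then have z: "force (v b t) t = 0" using ge by simp
    have ct: "isCont (v b) t" using v_DERIV[OF t(1)] by (rule DERIV_isCont)
    then have ev: "\<forall>\<^sub>F s in nhds t. - R < v b s \<and> v b s < R"
      using low up by (auto intro!: eventually_conj order_tendstoD simp: isCont_def tendsto_at_iff_tendsto_nhds)
    have ev': "\<forall>\<^sub>F s in nhds t. force (v b s) s = h (v b s) - cos s"
      using ev by eventually_elim (auto intro!: force_id)
    have "DERIV (\<lambda>s. h (v b s) - cos s) t :> sin t"
      using DERIV_chain2[OF h_DERIV v_DERIV[OF t(1)], of b] pt
      by (auto intro!: derivative_eq_intros)
    then have D: "DERIV (\<lambda>s. force (v b s) s) t :> sin t"
      using DERIV_cong_ev[OF refl ev' refl, of "sin t"] by simp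
    have "sin t > 0" using t by (intro sin_gt_zero) auto
    from DERIV_pos_inc_left[OF D this] obtain d
      where d: "d > 0" "\<And>x. 0 < x \<Longrightarrow> x < d \<Longrightarrow> force (v b (t - x)) (t - x) < 0" using z by force
    define x where "x = min d t / 2"
    have x: "0 < x" "x < d" "x < t" using d t by (auto simp: x_def)
    have "p b t < p b (t - x)"
    proof (rule DERIV_neg_imp_decreasing_open[where f="p b"])
      fix y assume y: "t - x < y" "y < t"
      then have "force (v b y) y < 0" using d(2)[of "t - y"] x by simp
      then show "\<exists>z. DERIV (p b) y :> z \<and> z < 0"
        using p_DERIV[of y b] y x e2 by (intro exI[of _ "force (v b y) y / ep\<^sup>2"]) (simp add: divide_neg_pos)
    qed (use x in \<open>auto intro!: p_cont_on\<close>)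
    then show False using np[of "t - x"] pt x by simp
  qed
qed

text \<open>An interior zero of \<open>p\<close> would be a nondegenerate turn, after which
  \<open>p\<close> becomes positive while still inside \<open>[0, t]\<close>.\<close>

lemma p_neg_before:
  assumes b: "b \<le> U0" and t: "t \<le> pi / 2"
    and np: "\<And>s. 0 \<le> s \<Longrightarrow> s \<le> t \<Longrightarrow> p b s \<le> 0" and s: "0 < s" "s < t"
  shows "p b s < 0"
proof (rule ccontr)
  assume "\<not> ?thesis"
  then have z: "p b s = 0" using np[of s] s by simp
  have "force (v b s) s > 0" using s t np z by (intro turn_nondegenerate[OF b]) auto
  then have "force (v b s) s / ep\<^sup>2 > 0" using ep by simp
  from DERIV_pos_inc_right[OF p_DERIV[OF s(1)] this] obtain d
    where d: "d > 0" "\<And>x. 0 < x \<Longrightarrow> x < d \<Longrightarrow> p b s < p b (s + x)" by blast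
  define x where "x = min d (t - s) / 2"
  have "0 < x" "x < d" "x \<le> (t - s) / 2" using d s by (auto simp: x_def)
  then have "0 < x" "x < d" "s + x \<le> t" using s by (auto simp: field_simps)
  then show False using d(2)[of x] z np[of "s + x"] s by simp
qed

text \<open>The sign condition is weak because that is what survives a limit in \<open>b\<close>; by
  \<open>p_neg_before\<close> the time \<open>t\<close> is still the first positive zero of
  \<open>p\<close>.\<close>

definition turn :: "real \<Rightarrow> real \<Rightarrow> bool" where
  "turn b t \<longleftrightarrow> b \<le> U0 \<and> 0 < t \<and> t < pi / 2 \<and> p b t = 0 \<and> (\<forall>s. 0 \<le> s \<longrightarrow> s \<le> t \<longrightarrow> p b s \<le> 0)"

lemma turnD:
  assumes "turn b t"
  shows "b \<le> U0" "0 < t" "t < pi / 2" "p b t = 0" "\<And>s. 0 \<le> s \<Longrightarrow> s \<le> t \<Longrightarrow> p b s \<le> 0"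
    "- R < v b t" "force (v b t) t > 0" "\<And>s. 0 < s \<Longrightarrow> s < t \<Longrightarrow> p b s < 0"
  using assms turn_nondegenerate[of b t] p_neg_before[of b t] unfolding turn_def by auto

lemma first_turn:
  assumes q0: "q b 0 < 0" and t: "0 \<le> t" "q b t \<ge> 0"
  obtains s where "0 < s" "s \<le> t" "p b s = 0" "\<And>x. 0 \<le> x \<Longrightarrow> x < s \<Longrightarrow> q b x < 0"
proof -
  have qc: "continuous_on {0..t} (q b)"
    using continuous_on_compose2[OF q_cont, of "{0..t}" "\<lambda>x. (b, x)"]
    by (simp add: continuous_on_Pair image_subset_iff)
  have "closed ({0..t} \<inter> q b -` {0..})" by (rule continuous_closed_preimage[OF qc]) auto
  then have "compact ({0..t} \<inter> q b -` {0..})"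
    unfolding compact_eq_bounded_closed by (auto intro: bounded_subset[of "{0..t}"])
  then obtain s where s: "s \<in> {0..t} \<inter> q b -` {0..}" "\<And>x. x \<in> {0..t} \<inter> q b -` {0..} \<Longrightarrow> s \<le> x"
    using compact_attains_inf[of "{0..t} \<inter> q b -` {0..}"] t by force
  have lt: "q b x < 0" if "0 \<le> x" "x < s" for x using s(2)[of x] that s(1) by force
  have "s \<noteq> 0" using q0 s(1) by auto
  then have sp: "s > 0" using s(1) by auto
  have "q b s \<le> 0"
  proof (rule continuous_le_on_closure[of "{0..<s}" "q b" s])
    show "continuous_on (closure {0..<s}) (q b)"
      using sp s(1) by (auto intro: continuous_on_subset[OF qc])
    show "s \<in> closure {0..<s}" using sp by simp
  qed (use lt in force)
  then have "q b s = 0" using s(1) by auto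
  then show ?thesis using that[of s] sp s(1) lt by (auto simp: p_def)
qed

text \<open>At the level \<open>U0\<close> the force is \<open>1 - cos y\<close>, positive for small
  \<open>y > 0\<close>, so only the fall \<open>W\<close> itself could make it negative, and by less
  than \<open>4 * lam * W\<close>. Integrating twice over a short time gives
  \<open>W < W\<close>.\<close>

lemma U0_not_falling:
  assumes T: "0 < T" and np: "\<And>s. 0 \<le> s \<Longrightarrow> s \<le> T \<Longrightarrow> p U0 s \<le> 0"
  shows False
proof -
  \<comment> \<open>Short enough for \<open>2 * R * t \<le> ep\<close>, hence
    \<open>4 * lam * t\<^sup>2 \<le> ep\<^sup>2\<close>, the factor gained by the double
    integration.\<close>
  define t where "t = min (min T 1) (ep / (2 * (R + 1)))"
  have t: "0 < t" "t \<le> T" "t \<le> 1" "t \<le> ep / (2 * (R + 1))"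
    using T ep R_pos by (auto simp: t_def)
  have "t * t * (4 * lam) \<le> ep\<^sup>2"
  proof -
    have "t * (2 * (R + 1)) \<le> ep" using t R_pos by (simp add: field_simps)
    then have "t * (2 * R) \<le> ep" using t R_pos by (simp add: algebra_simps)
    then have "(t * (2 * R))\<^sup>2 \<le> ep\<^sup>2" using t R_pos by (intro power_mono) auto
    then have "4 * (t * t) * (R * R) \<le> ep\<^sup>2" by (simp add: power2_eq_square mult_ac)
    then show ?thesis by (simp add: R_mult mult_ac)
  qed
  note tt = this
  obtain x where x: "0 < x" "x < t" "v U0 t - v U0 0 = (t - 0) * p U0 x"
    using MVT_DERIV[of 0 t "v U0" "p U0"] t v_DERIV v_cont_on by auto
  obtain y where y: "0 < y" "y < x" "p U0 x - p U0 0 = (x - 0) * (force (v U0 y) y / ep\<^sup>2)"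
    using MVT_DERIV[of 0 x "p U0" "\<lambda>y. force (v U0 y) y / ep\<^sup>2"] x p_DERIV p_cont_on by auto
  define W where "W = U0 - v U0 t"
  have vy: "v U0 t \<le> v U0 y" "v U0 y \<le> v U0 0"
    using x y t np by (auto intro!: v_antimono)
  then have W: "0 \<le> W" "U0 - v U0 y \<le> W" "0 \<le> U0 - v U0 y" by (auto simp: W_def v_0)
  have "cos y < cos 0" using x y t pi_gt3 by (intro cos_monotone_0_pi) auto
  moreover have "force U0 y = 1 - cos y" using U0 R_pos a_pos by (simp add: force_id)
  moreover have "4 * lam * (U0 - v U0 y) \<le> 4 * lam * W"
    using W lam_pos by (intro mult_left_mono) auto
  ultimately have "- force (v U0 y) y < 4 * lam * W"
    using force_lipschitz[of U0 y "v U0 y"] W by simp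
  moreover have We: "W = (t * x / ep\<^sup>2) * (- force (v U0 y) y)"
    using x y by (simp add: W_def v_0 p_0)
  moreover have "t * x / ep\<^sup>2 > 0" using t x ep by simp
  ultimately have "W < (t * x / ep\<^sup>2) * (4 * lam * W)"
    by (metis mult_strict_left_mono)
  also have "\<dots> \<le> (t * t / ep\<^sup>2) * (4 * lam * W)"
    using t x W lam_pos by (intro mult_right_mono divide_right_mono mult_left_mono) auto
  also have "\<dots> = (t * t * (4 * lam) / ep\<^sup>2) * W" by simp
  also have "\<dots> \<le> 1 * W" using tt ep W by (intro mult_right_mono) auto
  finally show False by simp
qed

end

section \<open>Turning points and trapping\<close>

context shooting
begin

lemma q_cont_pair: "continuous_on S (\<lambda>z. q (f z) (g z))"
  if "continuous_on S f" "continuous_on S g" "\<And>z. z \<in> S \<Longrightarrow> 0 \<le> g z"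
  using continuous_on_compose2[OF q_cont, of S "\<lambda>z. (f z, g z)"] that
  by (simp add: continuous_on_Pair image_subset_iff)

lemma v_cont_pair: "continuous_on S (\<lambda>z. v (f z) (g z))"
  if "continuous_on S f" "continuous_on S g" "\<And>z. z \<in> S \<Longrightarrow> 0 \<le> g z"
  using continuous_on_compose2[OF v_cont, of S "\<lambda>z. (f z, g z)"] that
  by (simp add: continuous_on_Pair image_subset_iff)

text \<open>\<open>bb\<close> is the least starting value in \<open>[- R, U0]\<close> whose orbit
  stops falling by time \<open>T\<close>. Lower orbits have \<open>q < 0\<close> throughout
  \<open>[0, T]\<close>, so in the limit \<open>q bb \<le> 0\<close> there. A zero of
  \<open>q bb\<close> at a positive time before \<open>T\<close> would be nondegenerate and
  contradict this sign; hence the turn occurs exactly at \<open>T\<close>.\<close>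

lemma turn_at:
  assumes T: "0 < T" "T < pi / 2"
  obtains bb where "- R < bb" "turn bb T"
    "\<And>b t. - R \<le> b \<Longrightarrow> b \<le> bb \<Longrightarrow> 0 \<le> t \<Longrightarrow> t \<le> T \<Longrightarrow> p b t \<le> 0"
proof -
  have e2: "ep\<^sup>2 > 0" using ep by simp
  define B where "B = ({- R..U0} \<times> {0..T}) \<inter> (\<lambda>z. q (fst z) (snd z)) -` {0..}"
  have "closed B" unfolding B_def
    by (rule continuous_closed_preimage) (auto intro!: q_cont_pair continuous_intros closed_Times)
  moreover have "bounded B"
    by (rule bounded_subset[of "{- R..U0} \<times> {0..T}"]) (auto simp: B_def intro!: bounded_Times)
  ultimately have "compact (fst ` B)"
    by (intro compact_continuous_image continuous_intros) (simp add: compact_eq_bounded_closed)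
  \<comment> \<open>The initial force vanishes at \<open>U0\<close>, so the set to be minimized over
    is nonempty.\<close>
  moreover have "(U0, 0) \<in> B"
    using U0 T R_pos a_pos by (auto simp: B_def q_0 force_id)
  ultimately obtain bb where bb: "bb \<in> fst ` B" "\<And>x. x \<in> fst ` B \<Longrightarrow> bb \<le> x"
    using compact_attains_inf[of "fst ` B"] by blast
  then obtain r where r: "(bb, r) \<in> B" by force
  have bbr: "- R \<le> bb" "bb \<le> U0" "0 \<le> r" "r \<le> T" "0 \<le> q bb r"
    using r by (auto simp: B_def)
  have lt: "q b t < 0" if "- R \<le> b" "b < bb" "0 \<le> t" "t \<le> T" for b t
  proof (rule ccontr)
    assume "\<not> ?thesis"
    then have "(b, t) \<in> B" using that bbr by (auto simp: B_def)
    then show False using bb(2)[of b] that by force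
  qed
  \<comment> \<open>A falling orbit from \<open>- R\<close> stays at or below \<open>- R\<close>,
    whereas turns happen only above it. This leaves room below \<open>bb\<close> for the
    limit.\<close>
  have ne1: "bb \<noteq> - R"
  proof
    assume eq: "bb = - R"
    have "q (- R) 0 < 0" using e2 by (simp add: q_0 force_low)
    then obtain s where s: "0 < s" "s \<le> r" "p (- R) s = 0" "\<And>x. 0 \<le> x \<Longrightarrow> x < s \<Longrightarrow> q (- R) x < 0"
      using first_turn[of "- R" r] bbr eq by metis
    have np: "p (- R) x \<le> 0" if "0 \<le> x" "x \<le> s" for x
      using s(3) s(4)[of x] that by (cases "x = s") (auto simp: p_def mult_nonneg_nonpos)
    have "- R < v (- R) s"
      by (rule turn_nondegenerate) (use s np bbr T U0 in auto)
    moreover have "v (- R) s \<le> v (- R) 0" using s np by (intro v_antimono) auto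
    ultimately show False by (simp add: v_0)
  qed
  have le: "q bb t \<le> 0" if "0 \<le> t" "t \<le> T" for t
  proof (rule continuous_le_on_closure[of "{- R..<bb}" "\<lambda>b. q b t" bb])
    show "continuous_on (closure {- R..<bb}) (\<lambda>b. q b t)"
      using that by (intro q_cont_pair continuous_intros)
    show "bb \<in> closure {- R..<bb}" using ne1 bbr by simp
  qed (use lt that in \<open>force\<close>)
  have np: "p bb t \<le> 0" if "0 \<le> t" "t \<le> T" for t
    using le[OF that] that by (simp add: p_def mult_nonneg_nonpos)
  have ne2: "bb \<noteq> U0" using U0_not_falling[OF T(1)] np by blast
  have "q bb 0 < 0"
    using h_strict_mono[of bb U0] U0 ne2 bbr e2 R_pos a_pos
    by (simp add: q_0 force_id divide_neg_pos)
  moreover have qr: "q bb r = 0" using le[of r] bbr by simp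
  ultimately have r0: "r > 0" using bbr by (cases "r = 0") auto
  have pr: "p bb r = 0" by (simp add: p_def qr)
  have "r = T"
  proof (rule ccontr)
    assume "r \<noteq> T"
    then have "p bb r < 0" using bbr r0 T np by (intro p_neg_before[of bb T]) auto
    then show False using pr by simp
  qed
  then have "turn bb T" using pr T np bbr by (simp add: turn_def)
  moreover have "p b t \<le> 0" if "- R \<le> b" "b \<le> bb" "0 \<le> t" "t \<le> T" for b t
    using np[of t] lt[of b t] that by (cases "b = bb") (auto simp: p_def mult_nonneg_nonpos)
  ultimately show ?thesis using that[of bb] ne1 bbr by simp
qed

lemma turn_level_neg: "turn b s \<Longrightarrow> v b s < 0"
proof -
  assume t: "turn b s"
  have "v b s \<le> v b 0" using turnD[OF t] by (intro v_antimono) auto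
  then show ?thesis using turnD(1)[OF t] U0 a_pos by (simp add: v_0)
qed

text \<open>\<open>gap b s t\<close> is the energy difference at time \<open>t\<close> between the rest state at the level \<open>v b s\<close>
  of the turning point and the orbit.\<close>

definition gap :: "real \<Rightarrow> real \<Rightarrow> real \<Rightarrow> real" where
  "gap b s t = (lam - (v b t)\<^sup>2)\<^sup>2 / 4 - (lam - (v b s)\<^sup>2)\<^sup>2 / 4 - (v b t - v b s) * cos t - ep\<^sup>2 * (p b t)\<^sup>2 / 2"

text \<open>\<open>(lam - x\<^sup>2)\<^sup>2 / 4\<close> is the primitive of \<open>h\<close> that
  vanishes at both saddles. By the equation everything cancels except the term from differentiating
  the cosine.\<close>

lemma gap_DERIV:
  assumes t: "0 < t" and R: "\<bar>v b t\<bar> \<le> R"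
  shows "DERIV (gap b s) t :> (v b t - v b s) * sin t"
proof -
  have "ep\<^sup>2 \<noteq> 0" using ep by simp
  then show ?thesis unfolding gap_def[abs_def]
    by (auto intro!: derivative_eq_intros v_DERIV[OF t] p_DERIV[OF t]
        simp: force_id[OF R] h_def field_simps power2_eq_square power3_eq_cube)
qed

lemma gap_cont_on: "S \<subseteq> {0..} \<Longrightarrow> continuous_on S (gap b s)"
  unfolding gap_def[abs_def] by (intro continuous_intros v_cont_on p_cont_on) auto

lemma gap_turn: "turn b s \<Longrightarrow> gap b s s = 0"
  using turnD(4) by (simp add: gap_def)

text \<open>The gap increases as long as the orbit stays above the level of its turning point, which
  it could reach again only with a nonpositive gap.\<close>

lemma trapped:
  assumes tn: "turn b s" and t: "s < t" "t \<le> pi / 2"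
  shows "v b s < v b t" "v b t < R" "0 < gap b s t"
proof -
  note td = turnD[OF tn]
  have low: "- R < v b s" and c0: "v b s < 0" using td turn_level_neg[OF tn] by auto
  have "force (v b s) s / ep\<^sup>2 > 0" using td ep by simp
  from DERIV_pos_inc_right[OF p_DERIV[OF td(2)] this] td(4) obtain d1
    where d1: "d1 > 0" "\<And>x. 0 < x \<Longrightarrow> x < d1 \<Longrightarrow> 0 < p b (s + x)" by auto
  have "isCont (v b) s" using v_DERIV[OF td(2)] by (rule DERIV_isCont)
  then obtain d2 where d2: "d2 > 0" "\<And>x. dist x s < d2 \<Longrightarrow> dist (v b x) (v b s) < R"
    unfolding continuous_at_eps_delta using R_pos by blast
  define r where "r = min d1 d2 / 2"
  have r: "r > 0" "r < d1" "r < d2" using d1 d2 by (auto simp: r_def)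
  have init: "v b s < v b x \<and> v b x < R" if "s < x" "x \<le> s + r" for x
  proof
    show "v b s < v b x"
    proof (rule DERIV_pos_imp_increasing_open[where f = "v b", OF that(1)])
      fix y assume "s < y" "y < x"
      then show "\<exists>z. DERIV (v b) y :> z \<and> z > 0"
        using v_DERIV[of y b] d1(2)[of "y - s"] td that r by (intro exI[of _ "p b y"]) auto
    qed (use td in \<open>auto intro!: v_cont_on\<close>)
    show "v b x < R" using d2(2)[of x] that r c0 by (auto simp: dist_real_def)
  qed
  \<comment> \<open>Times at which the orbit is outside the strip between the turning level and
    \<open>R\<close>. At the first one the gap would be positive by monotonicity, yet nonpositive by
    its value on either edge; at \<open>R\<close> this uses that the potential vanishes and
    \<open>cos\<close> is nonnegative.\<close>
  define S where "S = {s + r..pi / 2} \<inter> v b -` ({..v b s} \<union> {R..})"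
  have incr: "gap b s s < gap b s m" if "s < m" "\<And>x. s < x \<Longrightarrow> x < m \<Longrightarrow> v b s < v b x \<and> v b x < R" "m \<le> pi / 2" for m
  proof (rule DERIV_pos_imp_increasing_open[where f = "gap b s", OF that(1)])
    fix y assume y: "s < y" "y < m"
    then have "0 < sin y" using td that by (intro sin_gt_zero) auto
    then show "\<exists>z. DERIV (gap b s) y :> z \<and> z > 0"
      using gap_DERIV[of y b s] that(2)[OF y] y td low by (intro exI[of _ "(v b y - v b s) * sin y"]) auto
  qed (use td in \<open>auto intro!: gap_cont_on\<close>)
  have "S = {}"
  proof (rule ccontr)
    assume "S \<noteq> {}"
    have "closed S" unfolding S_def
      by (rule continuous_closed_preimage) (use r td in \<open>auto intro!: v_cont_on\<close>)
    moreover have "bounded S" unfolding S_def by (rule bounded_subset[of "{s + r..pi / 2}"]) auto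
    ultimately obtain m where m: "m \<in> S" "\<And>x. x \<in> S \<Longrightarrow> m \<le> x"
      using compact_attains_inf[of S] \<open>S \<noteq> {}\<close> by (auto simp: compact_eq_bounded_closed)
    have mb: "s + r \<le> m" "m \<le> pi / 2" using m by (auto simp: S_def)
    have below: "v b s < v b x \<and> v b x < R" if "s < x" "x < m" for x
    proof (cases "x \<le> s + r")
      case False
      then have "\<not> (v b x \<le> v b s \<or> R \<le> v b x)" using m(2)[of x] that mb by (auto simp: S_def)
      then show ?thesis by auto
    qed (use init[of x] that in auto)
    then have pos: "0 < gap b s m" using incr[of m] below mb r gap_turn[OF tn] by auto
    have cm: "cos m \<ge> 0" using mb td r by (intro cos_ge_zero) auto
    from m(1) consider "v b m \<le> v b s" | "R \<le> v b m" by (auto simp: S_def)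
    then show False
    proof cases
      case 1
      have "v b s \<le> v b m"
      proof (rule continuous_ge_on_closure[of "{s<..<m}" "v b" m])
        show "continuous_on (closure {s<..<m}) (v b)" using td mb r by (intro v_cont_on) auto
        show "m \<in> closure {s<..<m}" using mb r by simp
        show "v b s \<le> v b x" if "x \<in> {s<..<m}" for x
          using below[of x] that by auto
      qed
      with 1 have "v b m = v b s" by simp
      then have "gap b s m = - (ep\<^sup>2 * (p b m)\<^sup>2 / 2)" by (simp add: gap_def)
      moreover have "0 \<le> ep\<^sup>2 * (p b m)\<^sup>2 / 2" by simp
      ultimately show False using pos by linarith
    next
      case 2
      have "v b m \<le> R"
      proof (rule continuous_le_on_closure[of "{s<..<m}" "v b" m])
        show "continuous_on (closure {s<..<m}) (v b)" using td mb r by (intro v_cont_on) auto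
        show "m \<in> closure {s<..<m}" using mb r by simp
        show "v b x \<le> R" if "x \<in> {s<..<m}" for x
          using below[of x] that by auto
      qed
      with 2 have e: "v b m = R" by simp
      have "0 \<le> (R - v b s) * cos m" using cm c0 R_pos by (intro mult_nonneg_nonneg) auto
      moreover have "0 \<le> (lam - (v b s)\<^sup>2)\<^sup>2 / 4" "0 \<le> ep\<^sup>2 * (p b m)\<^sup>2 / 2" by auto
      moreover have "gap b s m = - ((lam - (v b s)\<^sup>2)\<^sup>2 / 4) - (R - v b s) * cos m - ep\<^sup>2 * (p b m)\<^sup>2 / 2"
        by (simp add: gap_def e R_sq)
      ultimately show False using pos by linarith
    qed
  qed
  then have all: "v b s < v b x \<and> v b x < R" if "s < x" "x \<le> pi / 2" for x
    using init[of x] that by (cases "x \<le> s + r") (auto simp: S_def not_le disjoint_iff)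
  show "v b s < v b t" "v b t < R" using all t by auto
  show "0 < gap b s t" using incr[of t] all t gap_turn[OF tn] by auto
qed

lemma cos_le_compl: "t \<le> pi / 2 \<Longrightarrow> cos t \<le> pi / 2 - t"
  using sin_x_le_x[of "pi / 2 - t"] by (simp add: sin_diff)

text \<open>The gap grows at a rate of at most \<open>2 * R\<close>, the width of the strip that
  traps the orbit.\<close>

lemma gap_le:
  assumes tn: "turn b s" and t: "s \<le> t" "t \<le> pi / 2"
  shows "gap b s t \<le> 2 * R * (pi / 2 - s)"
proof (cases "t = s")
  case True
  then show ?thesis using gap_turn[OF tn] turnD[OF tn] R_pos by simp
next
  case False
  note td = turnD[OF tn]
  have "s < t" using t False by simp
  have D: "DERIV (gap b s) x :> (v b x - v b s) * sin x" if "s < x" "x < t" for x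
    using trapped[OF tn, of x] that t td by (intro gap_DERIV) auto
  obtain x where x: "s < x" "x < t" "gap b s t - gap b s s = (t - s) * ((v b x - v b s) * sin x)"
    by (rule MVT_DERIV[OF \<open>s < t\<close> gap_cont_on D]) (use td in auto)
  have tr: "v b s < v b x" "v b x < R" using trapped[OF tn, of x] x t by auto
  have sx: "0 \<le> sin x" "sin x \<le> 1" using x t td by (auto intro!: sin_ge_zero)
  have "(v b x - v b s) * sin x \<le> (2 * R) * 1"
    using tr sx td(6) by (intro mult_mono) auto
  note le = this
  have "(t - s) * ((v b x - v b s) * sin x) \<le> (pi / 2 - s) * (2 * R)"
    by (rule mult_mono) (use t tr sx le in auto)
  then show ?thesis using x gap_turn[OF tn] by (simp add: mult_ac)
qed

text \<open>The energy deficit with respect to the heteroclinic orbit of the unforced equation.\<close>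

definition deficit :: "real \<Rightarrow> real \<Rightarrow> real" where
  "deficit b t = (lam - (v b t)\<^sup>2)\<^sup>2 / 4 - ep\<^sup>2 * (p b t)\<^sup>2 / 2"

lemma deficit_gap: "deficit b t = gap b s t + (lam - (v b s)\<^sup>2)\<^sup>2 / 4 + (v b t - v b s) * cos t"
  by (simp add: deficit_def gap_def)

lemma trapped_weak:
  assumes tn: "turn b s" and t: "s \<le> t" "t \<le> pi / 2"
  shows "- R < v b t" "v b s \<le> v b t" "v b t < R" "0 \<le> gap b s t"
  using trapped[OF tn, of t] t turnD[OF tn] turn_level_neg[OF tn] R_pos gap_turn[OF tn]
  by (cases "t = s"; force)+

text \<open>The lower bound keeps the orbit away from the upper saddle while the forcing is on. The
  upper bound is small for a late turn near \<open>- R\<close>; it separates the orbit from the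
  origin and locates the extremal values.\<close>

lemma deficit_bounds:
  assumes tn: "turn b s" and t: "s \<le> t" "t \<le> pi / 2"
  shows "(v b t - v b s) * cos t \<le> deficit b t"
    "deficit b t \<le> 4 * R * (pi / 2 - s) + (lam - (v b s)\<^sup>2)\<^sup>2 / 4"
proof -
  note td = turnD[OF tn] and tr = trapped_weak[OF tn t]
  show "(v b t - v b s) * cos t \<le> deficit b t"
    unfolding deficit_gap[of b t s] using tr(4) by simp
  have "(v b t - v b s) * cos t \<le> (2 * R) * (pi / 2 - s)"
    using tr td cos_le_compl[of t] t by (intro mult_mono cos_ge_zero) auto
  then show "deficit b t \<le> 4 * R * (pi / 2 - s) + (lam - (v b s)\<^sup>2)\<^sup>2 / 4"
    unfolding deficit_gap[of b t s] using gap_le[OF tn t] by (simp add: algebra_simps)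
qed

text \<open>If the turning level stayed away from \<open>-R\<close>, the force would be of order one during a fixed
  time before the turning point and the orbit would have fallen by an amount of order \<open>\<epsilon>\<^sup>-\<^sup>2\<close>.\<close>

lemma turn_level_near:
  assumes tn: "turn b s" and rho: "- R + rho \<le> - a"
    and d: "0 < d" "d \<le> 1" "2 * d \<le> h (- R + rho)" "pi / 2 - d / 2 \<le> s"
    and e: "32 * ep\<^sup>2 * R < h (- R + rho) * d\<^sup>2"
  shows "v b s < - R + rho"
proof (rule ccontr)
  assume "\<not> ?thesis"
  then have c: "- R + rho \<le> v b s" by simp
  note td = turnD[OF tn]
  define k where "k = h (- R + rho)"
  have k: "0 < k" "2 * d \<le> k" using d by (auto simp: k_def)
  have s: "pi / 2 - d / 2 \<le> s" "s < pi / 2" "0 < s - d / 2" using d td pi_gt3 by auto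
  have dec: "v b y \<le> v b x" if "0 \<le> x" "x \<le> y" "y \<le> s" for x y
    using that td by (intro v_antimono) auto
  have vU: "v b x \<le> U0" if "0 \<le> x" "x \<le> s" for x
    using dec[of 0 x] that td by (simp add: v_0)
  \<comment> \<open>On this window \<open>h\<close> is at least \<open>k\<close> by monotonicity,
    and the forcing takes away at most \<open>d \<le> k / 2\<close>.\<close>
  have f: "k / 2 \<le> force (v b x) x" if "s - d / 2 \<le> x" "x \<le> s" for x
  proof -
    have "v b s \<le> v b x" "v b x \<le> U0" using that s dec[of x s] vU[of x] by auto
    then have "k \<le> h (v b x)" unfolding k_def using c U0 by (intro h_mono) auto
    moreover have "cos x \<le> d" using cos_le_compl[of x] that s d by auto
    moreover have "\<bar>v b x\<bar> \<le> R"
      using \<open>v b s \<le> v b x\<close> \<open>v b x \<le> U0\<close> td U0 a_pos R_pos by auto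
    ultimately show ?thesis using k by (simp add: force_id)
  qed
  \<comment> \<open>The force acting for at least \<open>d / 4\<close> has to bring this velocity to
    0. During the preceding \<open>d / 4\<close> the orbit therefore falls by
    \<open>k * d\<^sup>2 / (32 * ep\<^sup>2)\<close>, more than the room \<open>R\<close> available
    between 0 and \<open>- R\<close>.\<close>
  have pn: "p b x \<le> - (k * d / (8 * ep\<^sup>2))" if x: "s - d / 2 \<le> x" "x \<le> s - d / 4" for x
  proof -
    have "x < s" using x d by simp
    then obtain y where y: "x < y" "y < s" "p b s - p b x = (s - x) * (force (v b y) y / ep\<^sup>2)"
      using MVT_DERIV[of x s "p b" "\<lambda>y. force (v b y) y / ep\<^sup>2"] x s p_DERIV p_cont_on by auto
    have "(d / 4) * (k / 2 / ep\<^sup>2) \<le> (s - x) * (force (v b y) y / ep\<^sup>2)"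
      using x y f[of y] k d by (intro mult_mono divide_right_mono) auto
    then show ?thesis using y td(4) by (simp add: mult_ac)
  qed
  obtain y where y: "s - d / 2 < y" "y < s - d / 4" "v b (s - d / 4) - v b (s - d / 2) = (s - d / 4 - (s - d / 2)) * p b y"
    by (rule MVT_DERIV[of "s - d / 2" "s - d / 4" "v b" "p b"]) (use d s v_DERIV v_cont_on in auto)
  have "(d / 4) * p b y \<le> (d / 4) * (- (k * d / (8 * ep\<^sup>2)))"
    using y pn[of y] d by (intro mult_left_mono) auto
  then have "v b (s - d / 2) - v b (s - d / 4) \<ge> k * d\<^sup>2 / (32 * ep\<^sup>2)"
    using y by (simp add: power2_eq_square mult_ac)
  moreover have "v b (s - d / 2) \<le> U0" "v b s \<le> v b (s - d / 4)"
    using vU[of "s - d / 2"] dec[of "s - d / 4" s] d s by auto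
  ultimately have "k * d\<^sup>2 / (32 * ep\<^sup>2) \<le> R" using td(6) U0 a_pos by simp
  then have "k * d\<^sup>2 \<le> R * (32 * ep\<^sup>2)" using ep by (simp add: field_simps)
  then show False using e by (simp add: k_def mult_ac)
qed

end

section \<open>Rotation around the origin\<close>

text \<open>\<open>z * exp (- g)\<close>, with \<open>g\<close> the primitive of
  \<open>z' / z\<close>, has derivative 0. The imaginary part of \<open>g\<close> is thus a
  continuous argument of \<open>z t / z 0\<close>, obtained without choosing branches of the
  logarithm.\<close>

lemma polar_integral:
  fixes z z' :: "real \<Rightarrow> complex"
  assumes z: "\<And>x. x \<in> {0..T} \<Longrightarrow> (z has_vector_derivative z' x) (at x within {0..T})"
    and z': "continuous_on {0..T} z'" and nz: "\<And>x. x \<in> {0..T} \<Longrightarrow> z x \<noteq> 0" and t: "t \<in> {0..T}"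
  shows "z t = z 0 * exp (integral {0..t} (\<lambda>x. z' x / z x))"
proof -
  define g where "g = (\<lambda>t. integral {0..t} (\<lambda>x. z' x / z x))"
  have zc: "continuous_on {0..T} z"
    unfolding continuous_on_eq_continuous_within using z has_vector_derivative_continuous by blast
  have g: "(g has_vector_derivative z' x / z x) (at x within {0..T})" if "x \<in> {0..T}" for x
    unfolding g_def using that nz
    by (intro integral_has_vector_derivative continuous_intros z' zc) auto
  have "((\<lambda>x. z x * exp (- g x)) has_derivative (\<lambda>h. 0)) (at x within {0..T})" if x: "x \<in> {0..T}" for x
  proof -
    have "((exp \<circ> (\<lambda>x. - g x)) has_vector_derivative (- (z' x / z x)) * exp (- g x)) (at x within {0..T})"
      using x by (intro field_vector_diff_chain_within) (auto intro!: derivative_eq_intros g)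
    then have "((\<lambda>x. z x * exp (- g x)) has_vector_derivative
        z x * ((- (z' x / z x)) * exp (- g x)) + z' x * exp (- g x)) (at x within {0..T})"
      by (intro has_vector_derivative_mult z x) (simp add: o_def)
    then show ?thesis using nz[OF x] by (simp add: has_vector_derivative_def)
  qed
  then obtain c where c: "\<And>x. x \<in> {0..T} \<Longrightarrow> z x * exp (- g x) = c"
    using has_derivative_zero_constant[of "{0..T}" "\<lambda>x. z x * exp (- g x)"] by auto
  have "z t * exp (- g t) = z 0"
    using c[OF t] c[of 0] t by (simp add: g_def)
  then have "z t = z 0 * exp (g t)" by (simp add: exp_minus field_simps)
  then show ?thesis by (simp add: g_def)
qed

context supercritical
begin

text \<open>The three terms serve the regions around the centre, the lower saddle and the upper
  saddle. That \<open>ep\<close> does not occur is what makes the angular speed of order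
  1/\<epsilon>.\<close>

definition spin_bound :: "real \<Rightarrow> real" where
  "spin_bound d = min (lam\<^sup>2 / 16) (min (a * (sin d - sin (3 * d / 4))) (2 * lam / 3 * sqrt (a * sin (d / 2))))"

lemma spin_bound_pos: "0 < d \<Longrightarrow> d < pi / 2 \<Longrightarrow> 0 < spin_bound d"
proof -
  assume d: "0 < d" "d < pi / 2"
  have "sin (3 * d / 4) < sin d" using d by (intro sin_monotone_2pi) auto
  moreover have "0 < sin (d / 2)" using d by (intro sin_gt_zero) auto
  ultimately show ?thesis using lam_pos a_pos by (simp add: spin_bound_def)
qed

end

context shooting
begin

text \<open>Up to a positive factor \<open>spin\<close> is the angular velocity of \<open>(- v, \<epsilon> p)\<close> around the origin.\<close>

definition spin :: "real \<Rightarrow> real \<Rightarrow> real" where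
  "spin b t = ep\<^sup>2 * (p b t)\<^sup>2 + (v b t)\<^sup>2 * (lam - (v b t)\<^sup>2) + v b t * cos t"

text \<open>Calibrated for the region \<open>\<bar>v\<bar> \<le> a\<close>. There
  \<open>ep\<^sup>2 * p\<^sup>2\<close> is at least \<open>lam\<^sup>2 / 8\<close> minus twice the
  deficit, which costs \<open>8 * R * (pi / 2 - s)\<close> and half the squared level term;
  \<open>v * cos t\<close> costs one more \<open>R * (pi / 2 - s)\<close>. Half of
  \<open>lam\<^sup>2 / 8\<close> remains.\<close>

definition tight :: "real \<Rightarrow> real \<Rightarrow> bool" where
  "tight b s \<longleftrightarrow> 9 * R * (pi / 2 - s) + (lam - (v b s)\<^sup>2)\<^sup>2 / 2 \<le> lam\<^sup>2 / 16"

lemma ep_p_sq: "ep\<^sup>2 * (p b t)\<^sup>2 = (lam - (v b t)\<^sup>2)\<^sup>2 / 2 - 2 * deficit b t"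
  by (simp add: deficit_def)

text \<open>Inside the strip \<open>spin\<close> is
  \<open>ep\<^sup>2 * p\<^sup>2 - v * (h v - cos t)\<close>. For
  \<open>\<bar>v\<bar> \<le> a\<close> the kinetic term dominates; for \<open>v \<ge> a\<close> the
  potential term and \<open>v * cos t\<close> are both nonnegative; for \<open>v \<le> - a\<close>
  monotonicity of \<open>h\<close> compares the force with its value at the turn.\<close>

lemma spin_cases:
  assumes tn: "turn b s" and ti: "tight b s" and t: "s \<le> t" "t \<le> pi / 2"
  shows "lam\<^sup>2 / 16 \<le> spin b t \<or> a * (h (v b s) - cos t) \<le> spin b t \<or>
    (a \<le> v b t \<and> lam / 3 * (lam - (v b t)\<^sup>2) \<le> spin b t)"
proof -
  note td = turnD[OF tn] and tr = trapped_weak[OF tn t] and db = deficit_bounds[OF tn t]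
  have ct: "0 \<le> cos t" "cos t \<le> pi / 2 - s" using t td cos_le_compl[of t] by (auto intro!: cos_ge_zero)
  have v2: "(v b t)\<^sup>2 \<le> lam" using tr by (intro abs_le_R) auto
  consider "\<bar>v b t\<bar> \<le> a" | "a \<le> v b t" | "v b t \<le> - a" by linarith
  then show ?thesis
  proof cases
    case 1
    have "(v b t)\<^sup>2 \<le> a\<^sup>2" using 1 a_pos by (simp add: abs_le_square_iff[symmetric])
    then have "(v b t)\<^sup>2 \<le> lam / 3" using a_sq by linarith
    then have "(lam / 2)\<^sup>2 \<le> (lam - (v b t)\<^sup>2)\<^sup>2" using lam_pos by (intro power_mono) auto
    then have 1: "lam\<^sup>2 / 8 \<le> (lam - (v b t)\<^sup>2)\<^sup>2 / 2" by (simp add: power_divide)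
    have "- (v b t) * cos t \<le> R * (pi / 2 - s)"
      using tr ct td R_pos by (intro mult_mono) auto
    moreover have "0 \<le> (v b t)\<^sup>2 * (lam - (v b t)\<^sup>2)" using v2 by simp
    ultimately have "lam\<^sup>2 / 16 \<le> spin b t"
      using 1 db(2) ti unfolding spin_def ep_p_sq tight_def by (simp add: algebra_simps)
    then show ?thesis by simp
  next
    case 2
    have "a\<^sup>2 \<le> (v b t)\<^sup>2" using 2 a_pos by (intro power_mono) auto
    then have "lam / 3 \<le> (v b t)\<^sup>2" using a_sq by linarith
    then have "lam / 3 * (lam - (v b t)\<^sup>2) \<le> (v b t)\<^sup>2 * (lam - (v b t)\<^sup>2)"
      using v2 by (intro mult_right_mono) auto
    moreover have "0 \<le> v b t * cos t" using 2 a_pos ct by simp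
    moreover have "0 \<le> ep\<^sup>2 * (p b t)\<^sup>2" by simp
    ultimately have "lam / 3 * (lam - (v b t)\<^sup>2) \<le> spin b t" unfolding spin_def by linarith
    then show ?thesis using 2 by simp
  next
    case 3
    have hc: "cos t \<le> h (v b s)"
    proof -
      have "cos t \<le> cos s" using t td by (intro cos_monotone_0_pi_le) auto
      also have "\<dots> < h (v b s)"
        using td turn_level_neg[OF tn] by (simp add: force_id)
      finally show ?thesis by simp
    qed
    have "h (v b s) \<le> h (v b t)" using tr 3 by (intro h_mono) auto
    then have "a * (h (v b s) - cos t) \<le> - v b t * (h (v b t) - cos t)"
      using 3 a_pos hc by (intro mult_mono) auto
    also have "\<dots> = spin b t - ep\<^sup>2 * (p b t)\<^sup>2"
      by (simp add: spin_def h_def algebra_simps power2_eq_square power3_eq_cube)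
    also have "\<dots> \<le> spin b t" by simp
    finally show ?thesis by simp
  qed
qed

lemma turn_level_cos: "turn b s \<Longrightarrow> cos s < h (v b s)"
  using turnD[of b s] turn_level_neg[of b s] by (simp add: force_id)

lemma spin_pos:
  assumes tn: "turn b s" and ti: "tight b s" and t: "s \<le> t" "t \<le> pi / 2"
  shows "0 < spin b t"
proof -
  note td = turnD[OF tn] and tr = trapped_weak[OF tn t]
  have "cos t \<le> cos s" using t td by (intro cos_monotone_0_pi_le) auto
  then have "0 < a * (h (v b s) - cos t)" using a_pos turn_level_cos[OF tn] by simp
  moreover have "0 < lam / 3 * (lam - (v b t)\<^sup>2)" using tr abs_less_R[of "v b t"] lam_pos by auto
  moreover have "0 < lam\<^sup>2 / 16" using lam_pos by simp
  ultimately show ?thesis using spin_cases[OF assms] by linarith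
qed

text \<open>The window starts \<open>d / 4\<close> after the turn, so \<open>cos t\<close> has
  dropped from \<open>sin d\<close> to at most \<open>sin (3 * d / 4)\<close>, which handles the
  lower saddle. It ends \<open>d / 2\<close> before \<pi>/2, so \<open>cos t\<close> is still at
  least \<open>sin (d / 2)\<close> and the deficit keeps the orbit from the upper saddle.\<close>

lemma spin_ge:
  assumes tn: "turn b s" and ti: "tight b s" and d: "d = pi / 2 - s" and t: "s + d / 4 \<le> t" "t \<le> s + d / 2"
  shows "spin_bound d \<le> spin b t"
proof -
  note td = turnD[OF tn]
  have d0: "0 < d" "d < pi / 2" using td d by auto
  have sc: "sin x = cos (pi / 2 - x)" for x :: real by (simp add: cos_diff)
  have tb: "pi / 2 - 3 * d / 4 \<le> t" "t \<le> pi / 2 - d / 2" using t d by linarith+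
  have t': "s \<le> t" "t \<le> pi / 2" "0 \<le> t" "t \<le> pi" using t d d0 td(2) by linarith+
  note tr = trapped_weak[OF tn t'(1,2)]
  have "cos t \<le> cos (pi / 2 - 3 * d / 4)" using tb t' d0 by (intro cos_monotone_0_pi_le) auto
  also have "\<dots> = sin (3 * d / 4)" by (rule sc[symmetric])
  finally have "sin d - sin (3 * d / 4) \<le> h (v b s) - cos t"
    using turn_level_cos[OF tn] sc[of d] d by simp
  then have 1: "a * (sin d - sin (3 * d / 4)) \<le> a * (h (v b s) - cos t)"
    using a_pos by simp
  have 2: "2 * lam / 3 * sqrt (a * sin (d / 2)) \<le> lam / 3 * (lam - (v b t)\<^sup>2)" if "a \<le> v b t"
  proof -
    have "sin (d / 2) \<le> cos t"
      unfolding sc[of "d / 2"] using tb t' d0 by (intro cos_monotone_0_pi_le) auto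
    moreover have "0 \<le> sin (d / 2)" using d0 by (intro sin_ge_zero) auto
    ultimately have "a * sin (d / 2) \<le> (v b t - v b s) * cos t"
      using that turn_level_neg[OF tn] a_pos by (intro mult_mono) auto
    also have "\<dots> \<le> deficit b t" by (rule deficit_bounds(1)[OF tn t'(1,2)])
    also have "\<dots> \<le> ((lam - (v b t)\<^sup>2) / 2)\<^sup>2" by (simp add: deficit_def power_divide)
    finally have "sqrt (a * sin (d / 2)) \<le> (lam - (v b t)\<^sup>2) / 2"
      using abs_less_R[of "v b t"] tr by (intro real_le_lsqrt) (auto simp: abs_less_iff)
    then have "2 * lam / 3 * sqrt (a * sin (d / 2)) \<le> 2 * lam / 3 * ((lam - (v b t)\<^sup>2) / 2)"
      using lam_pos by (intro mult_left_mono) auto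
    then show ?thesis by simp
  qed
  show ?thesis using spin_cases[OF tn ti t'(1,2)] 1 2 unfolding spin_bound_def by linarith
qed

section \<open>Polar angle of the orbit\<close>

text \<open>With this sign the curve starts at the positive number \<open>- b\<close>, so its angle
  starts at 0; \<open>zd\<close> is its time derivative.\<close>

definition zz :: "real \<Rightarrow> real \<Rightarrow> complex" where "zz b t = Complex (- v b t) (ep * p b t)"
definition zd :: "real \<Rightarrow> real \<Rightarrow> complex" where "zd b t = Complex (- p b t) (force (v b t) t / ep)"
definition angle :: "real \<Rightarrow> real \<Rightarrow> real" where
  "angle b t = Im (integral {0..t} (\<lambda>x. zd b x / zz b x))"

lemma force_cont_pair: "continuous_on S (\<lambda>z. force (f z) (g z))"
  if "continuous_on S f" "continuous_on S g"
  using continuous_on_compose2[OF continuous_on_force, of S "\<lambda>z. (g z, f z)"] that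
  by (simp add: continuous_on_Pair)

lemma zz_cont_pair: "continuous_on S (\<lambda>z. zz (f z) (g z))"
  if "continuous_on S f" "continuous_on S g" "\<And>z. z \<in> S \<Longrightarrow> 0 \<le> g z"
  unfolding zz_def p_def by (intro continuous_intros v_cont_pair q_cont_pair that)

lemma zd_cont_pair: "continuous_on S (\<lambda>z. zd (f z) (g z))"
  if "continuous_on S f" "continuous_on S g" "\<And>z. z \<in> S \<Longrightarrow> 0 \<le> g z"
  unfolding zd_def p_def using ep
  by (intro continuous_intros v_cont_pair q_cont_pair force_cont_pair that) auto

definition regular :: "real \<Rightarrow> bool" where
  "regular b \<longleftrightarrow> (\<forall>t\<in>{0..pi / 2}. zz b t \<noteq> 0)"

lemma zz_nonzero: "v b t \<noteq> 0 \<Longrightarrow> zz b t \<noteq> 0"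
  by (simp add: zz_def complex_eq_iff)

lemma quot_cont: "regular b \<Longrightarrow> continuous_on {0..pi / 2} (\<lambda>x. zd b x / zz b x)"
  unfolding regular_def by (intro continuous_intros zz_cont_pair zd_cont_pair) auto

lemma polar:
  assumes b: "b < 0" and r: "regular b" and t: "0 \<le> t" "t \<le> pi / 2"
  obtains r where "r > 0" "- v b t = r * cos (angle b t)" "ep * p b t = r * sin (angle b t)"
proof -
  have d: "(zz b has_vector_derivative zd b x) (at x within {0..pi / 2})" if "x \<in> {0..pi / 2}" for x
  proof -
    have sub: "{0..pi / 2} \<subseteq> {0..}" by auto
    have "(v b has_real_derivative p b x) (at x within {0..pi / 2})"
      using DERIV_subset[OF v_deriv sub, of x b] that by (simp add: p_def)
    moreover have "(p b has_real_derivative force (v b x) x / ep\<^sup>2) (at x within {0..pi / 2})"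
      using DERIV_subset[OF p_deriv sub, of x b] that by (simp add: p_def[abs_def])
    ultimately show ?thesis
      unfolding has_vector_derivative_complex_iff zz_def[abs_def] zd_def
      using ep by (auto intro!: derivative_eq_intros simp: power2_eq_square)
  qed
  have "zz b t = zz b 0 * exp (integral {0..t} (\<lambda>x. zd b x / zz b x))"
    by (rule polar_integral[OF d]) (use r t in \<open>auto simp: regular_def intro!: zd_cont_pair\<close>)
  also have "zz b 0 = of_real (- b)" by (simp add: zz_def v_0 p_0 complex_eq_iff)
  finally have e: "zz b t = of_real (- b) * exp (integral {0..t} (\<lambda>x. zd b x / zz b x))" .
  define r where "r = - b * exp (Re (integral {0..t} (\<lambda>x. zd b x / zz b x)))"
  show ?thesis
  proof
    show "r > 0" using b by (simp add: r_def mult_neg_pos)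
    show "- v b t = r * cos (angle b t)"
      using arg_cong[OF e, of Re] by (simp add: zz_def r_def angle_def Re_exp)
    show "ep * p b t = r * sin (angle b t)"
      using arg_cong[OF e, of Im] by (simp add: zz_def r_def angle_def Im_exp)
  qed
qed

lemma angle_deriv_within:
  assumes r: "regular b" and t: "t \<in> {0..pi / 2}"
  shows "(angle b has_real_derivative Im (zd b t / zz b t)) (at t within {0..pi / 2})"
  unfolding angle_def[abs_def]
  by (intro has_field_derivative_Im integral_has_vector_derivative quot_cont r t)

lemma angle_cont_on: "regular b \<Longrightarrow> S \<subseteq> {0..pi / 2} \<Longrightarrow> continuous_on S (angle b)"
  by (rule continuous_on_subset[OF DERIV_continuous_on[OF angle_deriv_within]])

lemma angle_DERIV:
  assumes r: "regular b" and t: "0 < t" "t < pi / 2" and v: "\<bar>v b t\<bar> \<le> R"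
  shows "DERIV (angle b) t :> spin b t / (ep * ((v b t)\<^sup>2 + ep\<^sup>2 * (p b t)\<^sup>2))"
proof -
  have "Im (zd b t / zz b t) = spin b t / (ep * ((v b t)\<^sup>2 + ep\<^sup>2 * (p b t)\<^sup>2))"
  proof -
    have "Im (zd b t / zz b t) = (force (v b t) t / ep * (- v b t) + p b t * (ep * p b t)) / ((v b t)\<^sup>2 + ep\<^sup>2 * (p b t)\<^sup>2)"
      unfolding Im_divide by (simp add: zz_def zd_def power_mult_distrib)
    also have "force (v b t) t / ep * (- v b t) + p b t * (ep * p b t) = spin b t / ep"
      using ep by (simp add: force_id[OF v] spin_def h_def field_simps power2_eq_square power3_eq_cube)
    finally show ?thesis by simp
  qed
  moreover have "at t within {0..pi / 2} = at t" using t by (intro at_within_interior) simp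
  ultimately show ?thesis using angle_deriv_within[OF r, of t] t by simp
qed

lemma angle_0: "angle b 0 = 0" by (simp add: angle_def)

text \<open>While \<open>v\<close> is negative the curve stays in the open right half plane, so the
  angle, starting at 0, cannot cross a zero of the cosine.\<close>

lemma angle_before:
  assumes b: "b < 0" and r: "regular b" and t: "0 \<le> t" "t \<le> pi / 2"
    and neg: "\<And>x. 0 \<le> x \<Longrightarrow> x \<le> t \<Longrightarrow> v b x < 0"
  shows "\<bar>angle b t\<bar> < pi / 2"
proof (rule ccontr)
  assume n: "\<not> ?thesis"
  have c: "0 < cos (angle b x)" if x: "0 \<le> x" "x \<le> t" for x
  proof -
    obtain r where "r > 0" "- v b x = r * cos (angle b x)"
      using polar[OF b r, of x] x t by auto
    moreover from this have "0 < r * cos (angle b x)" using neg[OF x] by linarith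
    ultimately show ?thesis by (simp add: zero_less_mult_iff)
  qed
  have ct: "continuous_on {0..t} (angle b)" using t by (intro angle_cont_on r) auto
  from n consider "pi / 2 \<le> angle b t" | "angle b t \<le> - (pi / 2)" by linarith
  then show False
  proof cases
    case 1
    obtain x where x: "0 \<le> x" "x \<le> t" "angle b x = pi / 2"
      using IVT'[of "angle b" 0 "pi / 2" t] 1 t ct by (auto simp: angle_0)
    show False using c[OF x(1,2)] unfolding x(3) by simp
  next
    case 2
    obtain x where x: "0 \<le> x" "x \<le> t" "angle b x = - (pi / 2)"
      using IVT2'[of "angle b" t "- (pi / 2)" 0] 2 t ct by (auto simp: angle_0)
    show False using c[OF x(1,2)] unfolding x(3) by simp
  qed
qed

lemma v_neg_before: "turn b s \<Longrightarrow> 0 \<le> x \<Longrightarrow> x \<le> s \<Longrightarrow> v b x < 0"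
proof -
  assume tn: "turn b s" and x: "0 \<le> x" "x \<le> s"
  have "v b x \<le> v b 0" using turnD[OF tn] x by (intro v_antimono) auto
  then show ?thesis using turnD(1)[OF tn] U0 a_pos by (simp add: v_0)
qed

lemma turn_regular:
  assumes tn: "turn b s" and ti: "tight b s"
  shows "regular b"
  unfolding regular_def
proof
  fix t assume t: "t \<in> {0..pi / 2}"
  show "zz b t \<noteq> 0"
  proof (cases "t \<le> s")
    case True
    then show ?thesis using v_neg_before[OF tn, of t] t by (intro zz_nonzero) auto
  next
    case False
    then have "0 < spin b t" using t by (intro spin_pos[OF tn ti]) auto
    then show ?thesis using ep by (auto simp: zz_def complex_eq_iff spin_def)
  qed
qed

lemma turn_start_neg: "turn b s \<Longrightarrow> b < 0"
  using turnD(1)[of b s] U0 a_pos by simp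

text \<open>The turn makes the sine vanish before the angle can have left the interval from -\<pi>/2
  to \<pi>/2. All rotation is therefore counted from the turn on.\<close>

lemma angle_turn:
  assumes tn: "turn b s" and ti: "tight b s"
  shows "angle b s = 0"
proof -
  note td = turnD[OF tn] and r = turn_regular[OF tn ti]
  have "\<bar>angle b s\<bar> < pi / 2"
    using td by (intro angle_before turn_start_neg[OF tn] r v_neg_before[OF tn]) auto
  moreover obtain r where "r > 0" "ep * p b s = r * sin (angle b s)"
    using polar[OF turn_start_neg[OF tn] r, of s] td by auto
  then have "sin (angle b s) = 0" using td by simp
  ultimately show ?thesis using sin_gt_zero[of "angle b s"] sin_gt_zero[of "- angle b s"]
    by (cases "angle b s" "0::real" rule: linorder_cases) auto
qed

lemma spin_denom:
  assumes tn: "turn b s" and ti: "tight b s" and t: "s \<le> t" "t \<le> pi / 2"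
  shows "0 < (v b t)\<^sup>2 + ep\<^sup>2 * (p b t)\<^sup>2" "(v b t)\<^sup>2 + ep\<^sup>2 * (p b t)\<^sup>2 \<le> lam + lam\<^sup>2 / 2"
proof -
  note td = turnD[OF tn] and tr = trapped_weak[OF tn t]
  have "zz b t \<noteq> 0" using turn_regular[OF tn ti] t td by (simp add: regular_def)
  then have "v b t \<noteq> 0 \<or> ep * p b t \<noteq> 0" by (auto simp: zz_def complex_eq_iff)
  then show "0 < (v b t)\<^sup>2 + ep\<^sup>2 * (p b t)\<^sup>2"
    using sum_power2_gt_zero_iff[of "v b t" "ep * p b t"] by (simp add: power_mult_distrib)
  have v2: "(v b t)\<^sup>2 \<le> lam" using tr by (intro abs_le_R) auto
  have "0 \<le> (v b t - v b s) * cos t" using tr t td by (intro mult_nonneg_nonneg cos_ge_zero) auto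
  then have "0 \<le> deficit b t" using deficit_bounds(1)[OF tn t] by simp
  moreover have "(lam - (v b t)\<^sup>2)\<^sup>2 \<le> lam\<^sup>2" using v2 by (intro power_mono) auto
  ultimately show "(v b t)\<^sup>2 + ep\<^sup>2 * (p b t)\<^sup>2 \<le> lam + lam\<^sup>2 / 2"
    unfolding ep_p_sq using v2 by simp
qed

lemma angle_strict_mono:
  assumes tn: "turn b s" and ti: "tight b s" and xy: "s \<le> x" "x < y" "y \<le> pi / 2"
  shows "angle b x < angle b y"
proof (rule DERIV_pos_imp_increasing_open[where f = "angle b", OF xy(2)])
  note td = turnD[OF tn]
  fix t assume t: "x < t" "t < y"
  have t': "s \<le> t" "t \<le> pi / 2" using t xy by auto
  have "0 < spin b t / (ep * ((v b t)\<^sup>2 + ep\<^sup>2 * (p b t)\<^sup>2))"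
    using spin_pos[OF tn ti t'] spin_denom[OF tn ti t'] ep by simp
  moreover have "DERIV (angle b) t :> spin b t / (ep * ((v b t)\<^sup>2 + ep\<^sup>2 * (p b t)\<^sup>2))"
    using t xy td trapped_weak[OF tn t'] by (intro angle_DERIV turn_regular[OF tn ti]) auto
  ultimately show "\<exists>z. DERIV (angle b) t :> z \<and> z > 0" by blast
qed (use xy turnD[OF tn] in \<open>auto intro!: angle_cont_on turn_regular[OF tn ti]\<close>)

text \<open>While the forcing is neither off nor at its strength at the turning point, the orbit keeps a
  fixed distance from both moving saddles; so it rotates at a speed of order \<open>1/\<epsilon>\<close>.\<close>

lemma angle_growth:
  assumes tn: "turn b s" and ti: "tight b s" and d: "d = pi / 2 - s"
  shows "d / 4 * (spin_bound d / (ep * (lam + lam\<^sup>2 / 2))) \<le> angle b (pi / 2)"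
proof -
  note td = turnD[OF tn]
  have d0: "0 < d" "d < pi / 2" using td d by auto
  define x where "x = s + d / 4"
  define y where "y = s + d / 2"
  have xy: "s < x" "x < y" "y < pi / 2" "y - x = d / 4"
    unfolding x_def y_def using d d0 by linarith+
  have D: "DERIV (angle b) t :> spin b t / (ep * ((v b t)\<^sup>2 + ep\<^sup>2 * (p b t)\<^sup>2))"
    if "x < t" "t < y" for t
    using that xy td trapped_weak[OF tn, of t] by (intro angle_DERIV turn_regular[OF tn ti]) auto
  obtain t where t: "x < t" "t < y"
    "angle b y - angle b x = (y - x) * (spin b t / (ep * ((v b t)\<^sup>2 + ep\<^sup>2 * (p b t)\<^sup>2)))"
    by (rule MVT_DERIV[OF xy(2) angle_cont_on[OF turn_regular[OF tn ti]] D]) (use xy td in auto)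
  have t': "s \<le> t" "t \<le> pi / 2" using t xy by auto
  have "spin_bound d \<le> spin b t" using t by (intro spin_ge[OF tn ti d]) (auto simp: x_def y_def)
  then have "spin_bound d / (ep * (lam + lam\<^sup>2 / 2)) \<le> spin b t / (ep * ((v b t)\<^sup>2 + ep\<^sup>2 * (p b t)\<^sup>2))"
    using spin_denom[OF tn ti t'] spin_pos[OF tn ti t'] ep spin_bound_pos[OF d0]
    by (intro frac_le mult_left_mono mult_pos_pos) auto
  then have "d / 4 * (spin_bound d / (ep * (lam + lam\<^sup>2 / 2))) \<le> angle b y - angle b x"
    unfolding t xy using d0 by (intro mult_left_mono) auto
  moreover have "angle b s < angle b x" "angle b y < angle b (pi / 2)"
    using xy by (auto intro!: angle_strict_mono[OF tn ti])
  ultimately show ?thesis using angle_turn[OF tn ti] by simp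
qed

section \<open>Existence of the orbit by continuity in the starting value\<close>

text \<open>If \<open>q\<close> reaches 0 before \<pi>/2, its first zero is a turn, and a turn
  before \<open>T\<close> would contradict the fall on \<open>[0, T]\<close>. Otherwise the orbit
  falls until \<pi>/2 and stays below its negative starting value.\<close>

lemma turn_or_negative:
  assumes b: "b < U0" and T: "T < pi / 2" and fall: "\<And>t. 0 \<le> t \<Longrightarrow> t \<le> T \<Longrightarrow> p b t \<le> 0" and bR: "- R \<le> b"
  shows "(\<exists>s. T \<le> s \<and> turn b s) \<or> (\<forall>t. 0 \<le> t \<longrightarrow> t \<le> pi / 2 \<longrightarrow> v b t < 0)"
proof (cases "\<exists>x. 0 \<le> x \<and> x < pi / 2 \<and> 0 \<le> q b x")
  case True
  then obtain x where x: "0 \<le> x" "x < pi / 2" "0 \<le> q b x" by blast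
  have "h b < 1" using h_strict_mono[OF b] U0 by auto
  then have "q b 0 < 0" using ep b bR U0 a_pos R_pos by (simp add: q_0 force_id divide_neg_pos)
  from first_turn[OF this x(1,3)] obtain s where
    s: "0 < s" "s \<le> x" "p b s = 0" "\<And>y. 0 \<le> y \<Longrightarrow> y < s \<Longrightarrow> q b y < 0" by metis
  have "p b y \<le> 0" if "0 \<le> y" "y \<le> s" for y
    using s(3) s(4)[of y] that by (cases "y = s") (auto simp: p_def mult_nonneg_nonpos)
  then have tn: "turn b s" using s x b by (auto simp: turn_def)
  have "T \<le> s"
  proof (rule ccontr)
    assume "\<not> T \<le> s"
    then have "p b s < 0" using T s by (intro p_neg_before[OF _ _ fall]) (use b in auto)
    then show False using s by simp
  qed
  then show ?thesis using tn by blast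
next
  case False
  have "v b t < 0" if t: "0 \<le> t" "t \<le> pi / 2" for t
  proof -
    have "v b t \<le> v b 0"
    proof (rule v_antimono)
      fix x assume "0 < x" "x < t"
      then have "0 \<le> x" "x < pi / 2" "0 < x" using t by auto
      then have "q b x < 0" "0 < x" using False not_le by blast+
      then show "p b x \<le> 0" by (simp add: p_def mult_le_0_iff)
    qed (use t in auto)
    then show ?thesis using b U0 a_pos by (simp add: v_0)
  qed
  then show ?thesis by blast
qed

text \<open>Orbits without a turn have a final angle below \<pi>/2, so \<open>A \<ge> pi / 2\<close>
  guarantees that the orbit found by the intermediate value theorem does turn.\<close>

lemma orbit_exists:
  assumes T: "0 < T" "T < pi / 2"
    and ti: "\<And>b s. turn b s \<Longrightarrow> T \<le> s \<Longrightarrow> tight b s"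
    and A: "pi / 2 \<le> A" "A \<le> (pi / 2 - T) / 4 * (spin_bound (pi / 2 - T) / (ep * (lam + lam\<^sup>2 / 2)))"
  obtains b s where "turn b s" "T \<le> s" "angle b (pi / 2) = A"
proof -
  obtain bb where bb: "- R < bb" "turn bb T"
    "\<And>b t. - R \<le> b \<Longrightarrow> b \<le> bb \<Longrightarrow> 0 \<le> t \<Longrightarrow> t \<le> T \<Longrightarrow> p b t \<le> 0"
    using turn_at[OF T] by metis
  have bU: "bb < U0"
    using turnD[OF bb(2)] U0_not_falling[OF T(1)] by (cases "bb = U0") auto
  have alt: "(\<exists>s. T \<le> s \<and> turn b s) \<or> (\<forall>t. 0 \<le> t \<longrightarrow> t \<le> pi / 2 \<longrightarrow> v b t < 0)"
    if "- R \<le> b" "b \<le> bb" for b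
    using bU that T bb(3)[OF that] by (intro turn_or_negative) auto
  have reg: "regular b" if b: "- R \<le> b" "b \<le> bb" for b
    using alt[OF b]
  proof (elim disjE exE conjE)
    fix s assume "T \<le> s" "turn b s"
    then show ?thesis using ti turn_regular by blast
  next
    assume "\<forall>t. 0 \<le> t \<longrightarrow> t \<le> pi / 2 \<longrightarrow> v b t < 0"
    then show ?thesis unfolding regular_def by (intro ballI zz_nonzero) force
  qed
  have "continuous_on ({- R..bb} \<times> cbox 0 (pi / 2)) (\<lambda>(b, x). zd b x / zz b x)"
    unfolding case_prod_unfold
    using reg by (intro continuous_intros zz_cont_pair zd_cont_pair) (auto simp: regular_def)
  then have "continuous_on {- R..bb} (\<lambda>b. integral (cbox 0 (pi / 2)) (\<lambda>x. zd b x / zz b x))"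
    by (rule integral_continuous_on_param)
  then have cont: "continuous_on {- R..bb} (\<lambda>b. angle b (pi / 2))"
    unfolding angle_def by (intro continuous_intros) simp
  have low: "angle b (pi / 2) < pi / 2" if "- R \<le> b" "b \<le> bb" "\<forall>t. 0 \<le> t \<longrightarrow> t \<le> pi / 2 \<longrightarrow> v b t < 0" for b
  proof -
    have "b < 0" using that bU U0 a_pos by simp
    then have "\<bar>angle b (pi / 2)\<bar> < pi / 2"
      using that reg by (intro angle_before) auto
    then show ?thesis by simp
  qed
  have "\<not> turn (- R) s" for s
  proof
    assume tn: "turn (- R) s"
    have "v (- R) s \<le> v (- R) 0" using turnD[OF tn] by (intro v_antimono) auto
    then show False using turnD(6)[OF tn] by (simp add: v_0)
  qed
  then have "angle (- R) (pi / 2) < pi / 2" using alt[of "- R"] bb(1) low[of "- R"] by auto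
  moreover have "A \<le> angle bb (pi / 2)"
    using angle_growth[OF bb(2) ti[OF bb(2)] refl] A by simp
  ultimately obtain b where b: "- R \<le> b" "b \<le> bb" "angle b (pi / 2) = A"
    using IVT'[of "\<lambda>b. angle b (pi / 2)" "- R" A bb] cont A bb(1) by auto
  then obtain s where "T \<le> s" "turn b s" using alt[of b] low[of b] A by force
  then show ?thesis using that b by blast
qed

end

section \<open>From one solution per accuracy to one family with limits\<close>

text \<open>At each parameter \<open>x\<close> the chosen object comes within \<open>x\<close> of
  the best attainable accuracy. The infimum need not be attained, but the slack \<open>x\<close> is
  positive and tends to 0 itself.\<close>

lemma choose_vanishing:
  fixes P C :: "real \<Rightarrow> 'a \<Rightarrow> bool"
  assumes ex: "\<And>\<eta>. \<eta> > 0 \<Longrightarrow> \<exists>e>0. \<forall>x\<in>{0<..<e}. \<exists>y. P x y \<and> C \<eta> y"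
    and mono: "\<And>\<eta> \<eta>' y. C \<eta> y \<Longrightarrow> \<eta> \<le> \<eta>' \<Longrightarrow> C \<eta>' y"
  obtains e f where "e > 0" "\<And>x. x \<in> {0<..<e} \<Longrightarrow> P x (f x)"
    "\<And>\<eta>. \<eta> > 0 \<Longrightarrow> \<forall>\<^sub>F x in at_right 0. C \<eta> (f x)"
proof -
  define I where "I = (\<lambda>x. {\<eta>. \<eta> > 0 \<and> (\<exists>y. P x y \<and> C \<eta> y)})"
  define f where "f = (\<lambda>x. SOME y. P x y \<and> C (Inf (I x) + x) y)"
  have bdd: "bdd_below (I x)" for x by (auto simp: I_def intro!: bdd_belowI[of _ 0])
  have f: "P x (f x) \<and> C (Inf (I x) + x) (f x)" if x: "x > 0" "\<eta> \<in> I x" for x \<eta>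
  proof -
    have "Inf (I x) < Inf (I x) + x" using x by simp
    then obtain \<eta>' where "\<eta>' \<in> I x" "\<eta>' < Inf (I x) + x" using x(2) by (metis cInf_lessD empty_iff)
    then have "\<exists>y. P x y \<and> C (Inf (I x) + x) y" unfolding I_def using mono by (auto intro: less_imp_le)
    then show ?thesis unfolding f_def by (rule someI_ex)
  qed
  \<comment> \<open>One fixed accuracy suffices to fix an interval on which something can be chosen
    at all.\<close>
  obtain e1 where e1: "e1 > 0" "\<And>x. x \<in> {0<..<e1} \<Longrightarrow> \<exists>y. P x y \<and> C 1 y" using ex[of 1] by auto
  show ?thesis
  proof
    show "e1 > 0" by fact
    fix x assume x: "x \<in> {0<..<e1}"
    then have "1 \<in> I x" using e1(2) by (auto simp: I_def)
    then show "P x (f x)" using f x by auto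
  next
    fix \<eta> :: real assume \<eta>: "\<eta> > 0"
    then obtain e where e: "e > 0" "\<And>x. x \<in> {0<..<e} \<Longrightarrow> \<exists>y. P x y \<and> C (\<eta> / 2) y" using ex[of "\<eta> / 2"] by auto
    have "C \<eta> (f x)" if x: "0 < x" "x < min e (\<eta> / 2)" for x
    proof -
      have i: "\<eta> / 2 \<in> I x" using e(2)[of x] x \<eta> by (auto simp: I_def)
      then have "Inf (I x) \<le> \<eta> / 2" by (rule cInf_lower[OF _ bdd])
      then have "Inf (I x) + x \<le> \<eta>" using x by simp
      then show ?thesis using f[OF x(1) i] mono by blast
    qed
    then show "\<forall>\<^sub>F x in at_right 0. C \<eta> (f x)"
      unfolding eventually_at_right_field using e \<eta> by (intro exI[of _ "min e (\<eta> / 2)"]) auto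
  qed
qed

section \<open>Reading off the solution\<close>

lemma at_within_Icc_0_pi_nontrivial: "x \<in> {0<..pi} \<Longrightarrow> at x within {0..pi} \<noteq> bot"
proof (cases "x = pi")
  case True
  then show ?thesis using at_within_Icc_at_left[of 0 pi] by simp
next
  case False
  assume "x \<in> {0<..pi}"
  then have "at x within {0..pi} = at x" using False by (intro at_within_interior) auto
  then show ?thesis by simp
qed

text \<open>Extrema are counted in the weak sense, so a strict minimum must also be excluded from
  the maxima; this needs points of the interval arbitrarily close to \<open>x\<close>, also at the
  end point.\<close>

lemma strict_local_min:
  assumes "x \<in> {0<..pi}" and ev: "\<forall>\<^sub>F y in at x within {0..pi}. u x < u y"
  shows "local_min_on u {0..pi} x" "\<not> local_max_on u {0..pi} x"
proof -
  show "local_min_on u {0..pi} x"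
    unfolding local_min_on_def using assms by (auto elim!: eventually_mono)
  show "\<not> local_max_on u {0..pi} x"
  proof
    assume "local_max_on u {0..pi} x"
    then have "\<forall>\<^sub>F y in at x within {0..pi}. u y \<le> u x" by (simp add: local_max_on_def)
    with ev have "\<forall>\<^sub>F y in at x within {0..pi}. False" by eventually_elim simp
    then show False using at_within_Icc_0_pi_nontrivial[OF assms(1)] by (simp add: eventually_False)
  qed
qed

lemma local_max_on_uminus: "local_max_on u S x \<longleftrightarrow> local_min_on (\<lambda>x. - u x) S x"
  by (simp add: local_max_on_def local_min_on_def)

lemma strict_local_max:
  assumes "x \<in> {0<..pi}" and "\<forall>\<^sub>F y in at x within {0..pi}. u y < u x"
  shows "local_max_on u {0..pi} x" "\<not> local_min_on u {0..pi} x"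
  using strict_local_min[of x "\<lambda>x. - u x"] assms
  by (simp_all add: local_max_on_def local_min_on_def)

lemma local_min_on_DERIV_zero:
  assumes m: "local_min_on u {0..pi} x" and x: "0 < x" "x < pi" and d: "DERIV u x :> l"
  shows "l = 0"
proof -
  have "at x within {0..pi} = at x" using x by (intro at_within_interior) auto
  then have "\<forall>\<^sub>F y in at x. u x \<le> u y" using m by (simp add: local_min_on_def)
  then obtain e where e: "e > 0" "\<And>y. y \<noteq> x \<Longrightarrow> dist y x < e \<Longrightarrow> u x \<le> u y"
    by (auto simp: eventually_at)
  then have "\<forall>y. \<bar>x - y\<bar> < e \<longrightarrow> u x \<le> u y"
    by (metis abs_minus_commute dist_real_def order_refl)
  then show ?thesis using DERIV_local_min[OF d e(1)] by blast
qed

lemma local_max_on_DERIV_zero: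
  assumes "local_max_on u {0..pi} x" "0 < x" "x < pi" "DERIV u x :> l"
  shows "l = 0"
proof -
  have "DERIV (\<lambda>x. - u x) x :> - l" using assms(4) by (rule DERIV_minus)
  then have "- l = 0" using assms(1-3) unfolding local_max_on_uminus by (intro local_min_on_DERIV_zero)
  then show ?thesis by simp
qed

definition layered_solution :: "real \<Rightarrow> nat \<Rightarrow> real \<Rightarrow> (real \<Rightarrow> real) \<Rightarrow> (real \<Rightarrow> real) \<Rightarrow> (nat \<Rightarrow> real) \<Rightarrow> (nat \<Rightarrow> real) \<Rightarrow> bool" where
  "layered_solution lam m ep u u' s t \<longleftrightarrow>
     forced_duffing_solution lam ep u u' \<and>
     u' 0 = 0 \<and> u' pi = 0 \<and> u (pi/2) = 0 \<and> u' (pi/2) < 0 \<and>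
     bij_betw s {1..m} (minima_right_half u) \<and>
     bij_betw t {1..m} (maxima_right_half u) \<and>
     pi/2 < s 1 \<and>
     (\<forall>j \<in> {1..m}. s j < t j) \<and>
     (\<forall>j \<in> {1..<m}. t j < s (j + 1)) \<and>
     t m = pi \<and>
     (\<forall>x. s m < x \<and> x < pi \<longrightarrow>
        u' x > 0 \<and> U_lower lam (pi/2) < u x \<and> u x < U_lower lam pi)"

text \<open>The quantitative form of the limits, monotone in \<open>\<eta>\<close>. The maximum with
  index \<open>m\<close> is left out: it sits at \<pi>, outside the layer.\<close>

definition layer_error_le :: "real \<Rightarrow> nat \<Rightarrow> real \<Rightarrow> (real \<Rightarrow> real) \<Rightarrow> (nat \<Rightarrow> real) \<Rightarrow> (nat \<Rightarrow> real) \<Rightarrow> bool" where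
  "layer_error_le lam m \<eta> u s t \<longleftrightarrow>
     (\<forall>j \<in> {1..m}. \<bar>s j - pi/2\<bar> \<le> \<eta> \<and> \<bar>u (s j) - U_lower lam (pi/2)\<bar> \<le> \<eta>) \<and>
     (\<forall>j \<in> {1..<m}. \<bar>t j - pi/2\<bar> \<le> \<eta> \<and> \<bar>u (t j) - U_upper lam (pi/2)\<bar> \<le> \<eta>)"

section \<open>The reflected orbit and its extrema\<close>

context shooting
begin

lemma v_strict_min:
  assumes t: "0 < t" and pt: "p b t = 0" and f: "0 < force (v b t) t"
  shows "\<forall>\<^sub>F y in at t. v b t < v b y"
proof -
  have f': "0 < force (v b t) t / ep\<^sup>2" using f ep by simp
  obtain d1 where d1: "d1 > 0" "\<And>x. 0 < x \<Longrightarrow> x < d1 \<Longrightarrow> 0 < p b (t + x)"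
    using DERIV_pos_inc_right[OF p_DERIV[OF t] f'] pt by auto
  obtain d2 where d2: "d2 > 0" "\<And>x. 0 < x \<Longrightarrow> x < d2 \<Longrightarrow> p b (t - x) < 0"
    using DERIV_pos_inc_left[OF p_DERIV[OF t] f'] pt by auto
  define d where "d = min (min d1 d2) t"
  have d: "d > 0" "d \<le> d1" "d \<le> d2" "d \<le> t" using d1 d2 t by (auto simp: d_def)
  have "v b t < v b y" if y: "y \<noteq> t" "dist y t < d" for y
  proof (cases "t < y")
    case True
    show ?thesis
    proof (rule DERIV_pos_imp_increasing_open[where f = "v b", OF True])
      fix x assume "t < x" "x < y"
      then show "\<exists>z. DERIV (v b) x :> z \<and> z > 0"
        using v_DERIV[of x b] d1(2)[of "x - t"] t y d by (intro exI[of _ "p b x"]) (auto simp: dist_real_def)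
    qed (use t in \<open>auto intro!: v_cont_on\<close>)
  next
    case False
    then have lt: "y < t" using y by simp
    have "0 < y" using y d by (auto simp: dist_real_def)
    show ?thesis
    proof (rule v_strict_antimono)
      fix x assume "y < x" "x < t"
      then show "p b x < 0" using d2(2)[of "t - x"] y d by (auto simp: dist_real_def)
    qed (use lt \<open>0 < y\<close> in auto)
  qed
  then show ?thesis unfolding eventually_at using d by (intro exI[of _ d]) auto
qed

lemma v_strict_max:
  assumes t: "0 < t" and pt: "p b t = 0" and f: "force (v b t) t < 0"
  shows "\<forall>\<^sub>F y in at t. v b y < v b t"
proof -
  have f': "force (v b t) t / ep\<^sup>2 < 0" using f ep by (simp add: divide_neg_pos)
  obtain d1 where d1: "d1 > 0" "\<And>x. 0 < x \<Longrightarrow> x < d1 \<Longrightarrow> p b (t + x) < 0"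
    using DERIV_neg_dec_right[OF p_DERIV[OF t] f'] pt by auto
  obtain d2 where d2: "d2 > 0" "\<And>x. 0 < x \<Longrightarrow> x < d2 \<Longrightarrow> 0 < p b (t - x)"
    using DERIV_neg_dec_left[OF p_DERIV[OF t] f'] pt by auto
  define d where "d = min (min d1 d2) t"
  have d: "d > 0" "d \<le> d1" "d \<le> d2" "d \<le> t" using d1 d2 t by (auto simp: d_def)
  have "v b y < v b t" if y: "y \<noteq> t" "dist y t < d" for y
  proof (cases "t < y")
    case True
    show ?thesis
    proof (rule v_strict_antimono)
      fix x assume "t < x" "x < y"
      then show "p b x < 0" using d1(2)[of "x - t"] y d by (auto simp: dist_real_def)
    qed (use t True in auto)
  next
    case False
    then have lt: "y < t" using y by simp
    have "0 < y" using y d by (auto simp: dist_real_def)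
    show ?thesis
    proof (rule DERIV_pos_imp_increasing_open[where f = "v b", OF lt])
      fix x assume "y < x" "x < t"
      then show "\<exists>z. DERIV (v b) x :> z \<and> z > 0"
        using v_DERIV[of x b] d2(2)[of "t - x"] \<open>0 < y\<close> y d by (intro exI[of _ "p b x"]) (auto simp: dist_real_def)
    qed (use \<open>0 < y\<close> in \<open>auto intro!: v_cont_on\<close>)
  qed
  then show ?thesis unfolding eventually_at using d by (intro exI[of _ d]) auto
qed

text \<open>The odd extension about \<open>\<pi>/2\<close> of the reflected orbit.\<close>

definition usol :: "real \<Rightarrow> real \<Rightarrow> real" where
  "usol b x = (if x \<in> {0..pi / 2} then - v b x else v b (pi - x))"
definition usol' :: "real \<Rightarrow> real \<Rightarrow> real" where
  "usol' b x = (if x \<in> {0..pi / 2} then - p b x else - p b (pi - x))"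

lemma usol_right:
  assumes "pi / 2 \<le> x"
  shows "v b (pi / 2) = 0 \<Longrightarrow> usol b x = v b (pi - x)" "usol' b x = - p b (pi - x)"
proof -
  have e: "pi - pi / 2 = pi / 2" by simp
  consider "x = pi / 2" | "x \<notin> {0..pi / 2}" using assms by fastforce
  note c = this
  show "v b (pi / 2) = 0 \<Longrightarrow> usol b x = v b (pi - x)"
    using c by cases (simp_all only: usol_def e if_False if_True, simp)
  show "usol' b x = - p b (pi - x)"
    using c by cases (simp_all only: usol'_def e if_False if_True, simp)
qed

lemma deriv_glue:
  fixes f g f' g' :: "real \<Rightarrow> real"
  assumes x: "x \<in> {0..pi}"
    and f: "x \<in> {0..pi / 2} \<Longrightarrow> (f has_real_derivative f' x) (at x within {0..pi / 2})"
    and g: "x \<in> {pi / 2..pi} \<Longrightarrow> (g has_real_derivative g' x) (at x within {pi / 2..pi})"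
    and e: "f (pi / 2) = g (pi / 2)" "f' (pi / 2) = g' (pi / 2)"
  shows "((\<lambda>x. if x \<in> {0..pi / 2} then f x else g x) has_real_derivative
    (if x \<in> {0..pi / 2} then f' x else g' x)) (at x within {0..pi})"
  unfolding has_real_derivative_iff_has_vector_derivative
proof (rule has_vector_derivative_If_within_closures[where T = "{pi / 2..pi}"])
  have c: "closure {0..pi / 2} \<inter> closure {pi / 2..pi} = {pi / 2}" by auto
  have s: "{0..pi / 2} \<union> {pi / 2} = {0..pi / 2}" "{pi / 2..pi} \<union> {pi / 2} = {pi / 2..pi}" by auto
  show "(f has_vector_derivative f' x) (at x within {0..pi / 2} \<union> closure {0..pi / 2} \<inter> closure {pi / 2..pi})"
    if "x \<in> {0..pi / 2} \<union> closure {0..pi / 2} \<inter> closure {pi / 2..pi}"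
    using that f unfolding c s has_real_derivative_iff_has_vector_derivative by blast
  show "(g has_vector_derivative g' x) (at x within {pi / 2..pi} \<union> closure {0..pi / 2} \<inter> closure {pi / 2..pi})"
    if "x \<in> {pi / 2..pi} \<union> closure {0..pi / 2} \<inter> closure {pi / 2..pi}"
    using that g unfolding c s has_real_derivative_iff_has_vector_derivative by blast
  have xe: "x = pi / 2" if "x \<in> closure {0..pi / 2}" "x \<in> closure {pi / 2..pi}"
    using that c by blast
  show "f x = g x" if "x \<in> closure {0..pi / 2}" "x \<in> closure {pi / 2..pi}"
    unfolding xe[OF that] by (fact e)
  show "f' x = g' x" if "x \<in> closure {0..pi / 2}" "x \<in> closure {pi / 2..pi}"
    unfolding xe[OF that] by (fact e)
  show "x \<in> {0..pi / 2} \<union> {pi / 2..pi}" using x linear[of x "pi / 2"] by auto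
  show "{0..pi} = {0..pi / 2} \<union> {pi / 2..pi}" by (rule ivl_disj_un_two_touch(4)[symmetric]) simp_all
qed

lemma deriv_reflect:
  assumes f: "\<And>t. 0 \<le> t \<Longrightarrow> (f has_real_derivative f' t) (at t within {0..})" and x: "x \<in> {pi / 2..pi}"
  shows "((\<lambda>x. f (pi - x)) has_real_derivative - f' (pi - x)) (at x within {pi / 2..pi})"
proof -
  have "(f has_real_derivative f' (pi - x)) (at (pi - x) within (\<lambda>x. pi - x) ` {pi / 2..pi})"
    using x by (intro DERIV_subset[OF f]) auto
  moreover have "((\<lambda>x. pi - x) has_real_derivative - 1) (at x within {pi / 2..pi})"
    by (auto intro!: derivative_eq_intros)
  ultimately show ?thesis
    using DERIV_image_chain[of f "f' (pi - x)" "\<lambda>x. pi - x" x "{pi / 2..pi}" "- 1"] by (simp add: o_def)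
qed

text \<open>The equation is invariant under \<open>u (pi - t) = - u t\<close>, and the bound
  \<open>R\<close> ensures that the truncated force is the original one.\<close>

lemma usol_solution:
  assumes z: "v b (pi / 2) = 0" and bd: "\<And>t. 0 \<le> t \<Longrightarrow> t \<le> pi / 2 \<Longrightarrow> \<bar>v b t\<bar> \<le> R"
  shows "forced_duffing_solution lam ep (usol b) (usol' b)"
  unfolding forced_duffing_solution_def
proof (intro exI ballI conjI)
  define F where "F = (\<lambda>t. force (v b t) t / ep\<^sup>2)"
  fix x assume x: "x \<in> {0..pi}"
  have vd: "(v b has_real_derivative p b t) (at t within {0..})" if "0 \<le> t" for t
    using v_deriv[OF that] by (simp add: p_def)
  have pd: "(p b has_real_derivative F t) (at t within {0..})" if "0 \<le> t" for t
    using p_deriv[OF that] by (simp add: p_def[abs_def] F_def)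
  show "(usol b has_real_derivative usol' b x) (at x within {0..pi})"
    unfolding usol_def[abs_def] usol'_def
  proof (rule deriv_glue[OF x])
    show "((\<lambda>x. - v b x) has_real_derivative - p b x) (at x within {0..pi / 2})" if "x \<in> {0..pi / 2}"
      using that by (intro DERIV_minus DERIV_subset[OF vd]) auto
  qed (use deriv_reflect[OF vd, of x] z in auto)
  show "(usol' b has_real_derivative (if x \<in> {0..pi / 2} then - F x else F (pi - x))) (at x within {0..pi})"
    unfolding usol'_def[abs_def]
  proof (rule deriv_glue[OF x])
    show "((\<lambda>x. - p b x) has_real_derivative - F x) (at x within {0..pi / 2})" if "x \<in> {0..pi / 2}"
      using that by (intro DERIV_minus DERIV_subset[OF pd]) auto
    show "((\<lambda>x. - p b (pi - x)) has_real_derivative F (pi - x)) (at x within {pi / 2..pi})" if "x \<in> {pi / 2..pi}"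
      using DERIV_minus[OF deriv_reflect[OF pd that]] by simp
    \<comment> \<open>Both one-sided second derivatives are 0, because \<open>v\<close> and the
      forcing vanish at \<pi>/2.\<close>
    show "- F (pi / 2) = F (pi - pi / 2)"
      using z R_pos by (simp add: F_def force_id h_def)
  qed simp
  show "ep\<^sup>2 * (if x \<in> {0..pi / 2} then - F x else F (pi - x)) = usol b x ^ 3 - lam * usol b x + cos x"
    using x ep bd[of x] bd[of "pi - x"] by (auto simp: F_def usol_def force_id h_def)
qed

text \<open>\<open>lam - w\<^sup>2\<close> factors as \<open>(R - w) * (R + w)\<close>, and the
  factor belonging to the farther saddle is at least \<open>R\<close>.\<close>

lemma near_R:
  assumes w: "\<bar>w\<bar> < R" and e: "\<eta> > 0" and d: "(lam - w\<^sup>2)\<^sup>2 / 4 \<le> (\<eta> * R)\<^sup>2 / 4"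
  shows "w \<le> 0 \<Longrightarrow> \<bar>w - (- R)\<bar> \<le> \<eta>" "0 \<le> w \<Longrightarrow> \<bar>w - R\<bar> \<le> \<eta>"
proof -
  have "(lam - w\<^sup>2)\<^sup>2 \<le> (\<eta> * R)\<^sup>2" using d by simp
  then have "lam - w\<^sup>2 \<le> \<eta> * R" by (rule power2_le_imp_le) (use e R_pos in simp)
  then have f: "(R - w) * (R + w) \<le> \<eta> * R"
    using R_mult by (simp add: algebra_simps power2_eq_square)
  show "\<bar>w - (- R)\<bar> \<le> \<eta>" if "w \<le> 0"
  proof -
    have "R * (R + w) \<le> (R - w) * (R + w)" using that w by (intro mult_right_mono) auto
    then have "R * (R + w) \<le> R * \<eta>" using f by (simp add: mult.commute)
    then show ?thesis using R_pos w by simp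
  qed
  show "\<bar>w - R\<bar> \<le> \<eta>" if "0 \<le> w"
  proof -
    have "(R - w) * R \<le> (R - w) * (R + w)" using that w by (intro mult_left_mono) auto
    then have "R * (R - w) \<le> R * \<eta>" using f by (simp add: mult.commute)
    then show ?thesis using R_pos w by simp
  qed
qed

text \<open>The critical points of the orbit after the turning point are the points where the angle is a
  multiple of \<open>\<pi>\<close>; even multiples are minima and odd ones are maxima.\<close>

lemma critical_points:
  assumes tn: "turn b s" and ti: "tight b s" and A: "angle b (pi / 2) = real (2 * n) * pi + pi / 2"
  obtains \<sigma> :: "nat \<Rightarrow> real" where
    "\<And>k. k \<le> 2 * n \<Longrightarrow> s \<le> \<sigma> k \<and> \<sigma> k < pi / 2"
    "\<sigma> 0 = s"
    "\<And>k l. k < l \<Longrightarrow> l \<le> 2 * n \<Longrightarrow> \<sigma> k < \<sigma> l"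
    "\<And>x. s \<le> x \<Longrightarrow> x \<le> pi / 2 \<Longrightarrow> p b x = 0 \<longleftrightarrow> x \<in> \<sigma> ` {..2 * n}"
    "\<And>k. k \<le> 2 * n \<Longrightarrow> even k \<Longrightarrow> v b (\<sigma> k) < 0 \<and> 0 < force (v b (\<sigma> k)) (\<sigma> k)"
    "\<And>k. k \<le> 2 * n \<Longrightarrow> odd k \<Longrightarrow> 0 < v b (\<sigma> k) \<and> force (v b (\<sigma> k)) (\<sigma> k) < 0"
proof -
  note td = turnD[OF tn] and r = turn_regular[OF tn ti] and b0 = turn_start_neg[OF tn]
  have a0: "angle b s = 0" by (rule angle_turn[OF tn ti])
  have mono: "angle b x < angle b y" if "s \<le> x" "x < y" "y \<le> pi / 2" for x y
    by (rule angle_strict_mono[OF tn ti that])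
  have inj: "x = y" if "s \<le> x" "x \<le> pi / 2" "s \<le> y" "y \<le> pi / 2" "angle b x = angle b y" for x y
    using mono[of x y] mono[of y x] that by (cases x y rule: linorder_cases) auto
  have ex: "\<exists>x. s \<le> x \<and> x \<le> pi / 2 \<and> angle b x = real k * pi" if "k \<le> 2 * n" for k
  proof -
    have "real k * pi \<le> real (2 * n) * pi" using that by (intro mult_right_mono) auto
    then have "real k * pi \<le> angle b (pi / 2)" unfolding A using pi_gt_zero by linarith
    then show ?thesis
      using IVT'[of "angle b" s "real k * pi" "pi / 2"] angle_cont_on[OF r, of "{s..pi / 2}"] a0 td
      by auto
  qed
  then obtain \<sigma> where \<sigma>: "\<And>k. k \<le> 2 * n \<Longrightarrow> s \<le> \<sigma> k \<and> \<sigma> k \<le> pi / 2 \<and> angle b (\<sigma> k) = real k * pi"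
    by metis
  have lt: "\<sigma> k < pi / 2" if k: "k \<le> 2 * n" for k
  proof (rule ccontr)
    assume "\<not> ?thesis"
    then have "\<sigma> k = pi / 2" using \<sigma>[OF k] by simp
    then have "real k * pi = real (2 * n) * pi + pi / 2" using \<sigma>[OF k] A by metis
    moreover have "real k * pi \<le> real (2 * n) * pi" using k by (intro mult_right_mono) auto
    ultimately show False using pi_gt_zero by linarith
  qed
  have crit: "p b x = 0 \<longleftrightarrow> x \<in> \<sigma> ` {..2 * n}" if x: "s \<le> x" "x \<le> pi / 2" for x
  proof -
    have "0 \<le> x" using x td by simp
    obtain r where r: "r > 0" "ep * p b x = r * sin (angle b x)"
      using polar[OF b0 r \<open>0 \<le> x\<close> x(2)] by metis
    have iff: "p b x = 0 \<longleftrightarrow> sin (angle b x) = 0"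
      using r ep by (metis mult_eq_0_iff order_less_irrefl)
    show ?thesis
    proof
      assume "p b x = 0"
      then obtain i :: int where i: "angle b x = of_int i * pi" using iff sin_zero_iff_int2 by blast
      have "0 \<le> angle b x" using mono[of s x] a0 x by (cases "x = s") auto
      then have "i \<ge> 0" using i pi_gt_zero by (auto simp: zero_le_mult_iff)
      have "angle b x \<le> angle b (pi / 2)" using mono[OF x(1) _ order_refl] x(2) by (metis le_less)
      then have "of_int i * pi \<le> (real (2 * n) + 1 / 2) * pi" using i A by (simp add: algebra_simps)
      then have "of_int i \<le> real (2 * n) + 1 / 2" by (rule mult_right_le_imp_le) simp
      \<comment> \<open>The last quarter turn is too short to reach another multiple of
        \<pi>.\<close>
      then have "i \<le> 2 * int n" by linarith
      define k where "k = nat i"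
      have k: "k \<le> 2 * n" "angle b x = real k * pi"
        using \<open>i \<ge> 0\<close> \<open>i \<le> 2 * int n\<close> i by (auto simp: k_def nat_le_iff)
      then have "x = \<sigma> k" using inj[OF x, of "\<sigma> k"] \<sigma>[OF k(1)] by metis
      then show "x \<in> \<sigma> ` {..2 * n}" using k by auto
    next
      assume "x \<in> \<sigma> ` {..2 * n}"
      then obtain k where "k \<le> 2 * n" "x = \<sigma> k" by auto
      then have "angle b x = real k * pi" using \<sigma> by auto
      then show "p b x = 0" using iff by simp
    qed
  qed
  have sgn: "(even k \<longrightarrow> v b (\<sigma> k) < 0 \<and> 0 < force (v b (\<sigma> k)) (\<sigma> k)) \<and>
    (odd k \<longrightarrow> 0 < v b (\<sigma> k) \<and> force (v b (\<sigma> k)) (\<sigma> k) < 0)" if k: "k \<le> 2 * n" for k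
  proof -
    have x: "s \<le> \<sigma> k" "\<sigma> k \<le> pi / 2" "0 \<le> \<sigma> k" using \<sigma>[OF k] td by auto
    note tr = trapped_weak[OF tn x(1,2)]
    obtain r where r: "r > 0" "- v b (\<sigma> k) = r * cos (angle b (\<sigma> k))"
      using polar[OF b0 r x(3,2)] by metis
    \<comment> \<open>Without the kinetic term \<open>spin\<close> is \<open>- v * force\<close>, so
      its positivity makes the force opposite in sign to \<open>v\<close>.\<close>
    have "p b (\<sigma> k) = 0" using crit[OF x(1,2)] k by auto
    then have "spin b (\<sigma> k) = - (v b (\<sigma> k) * force (v b (\<sigma> k)) (\<sigma> k))"
      using tr by (simp add: spin_def force_id h_def algebra_simps power2_eq_square power3_eq_cube)
    then have neg: "v b (\<sigma> k) * force (v b (\<sigma> k)) (\<sigma> k) < 0"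
      using spin_pos[OF tn ti x(1,2)] by simp
    have "cos (angle b (\<sigma> k)) = (- 1) ^ k" using \<sigma>[OF k] by (simp add: cos_npi)
    then have "- v b (\<sigma> k) = r * (- 1) ^ k" using r by simp
    then show ?thesis using neg r(1) by (auto simp: mult_less_0_iff)
  qed
  have less: "\<sigma> k < \<sigma> l" if "k < l" "l \<le> 2 * n" for k l
  proof (rule ccontr)
    assume n: "\<not> ?thesis"
    have k: "k \<le> 2 * n" using that by simp
    have "angle b (\<sigma> l) \<le> angle b (\<sigma> k)"
      using n \<sigma>[OF k] \<sigma>[OF that(2)] mono[of "\<sigma> l" "\<sigma> k"] by (metis le_less not_less)
    then have "real l * pi \<le> real k * pi" using \<sigma>[OF k] \<sigma>[OF that(2)] by metis
    then have "real l \<le> real k" by (rule mult_right_le_imp_le) simp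
    then show False using that(1) by simp
  qed
  have s0: "\<sigma> 0 = s" using inj[of "\<sigma> 0" s] \<sigma>[of 0] a0 td(3) by simp
  show ?thesis
    by (rule that[of \<sigma>]) (use \<sigma> lt s0 less crit sgn in blast)+
qed

lemma eventually_reflect:
  assumes "\<forall>\<^sub>F y in at (pi - x). Q y" and x: "pi / 2 < x" "x < pi"
  shows "\<forall>\<^sub>F y in at x within {0..pi}. pi / 2 \<le> y \<and> Q (pi - y)"
proof -
  obtain d where d: "d > 0" "\<And>y. y \<noteq> pi - x \<Longrightarrow> dist y (pi - x) < d \<Longrightarrow> Q y"
    using assms(1) by (auto simp: eventually_at)
  have "pi / 2 \<le> y \<and> Q (pi - y)" if "y \<noteq> x" "dist y x < min d (x - pi / 2)" for y
    using d(2)[of "pi - y"] that by (auto simp: dist_real_def)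
  then show ?thesis
    unfolding eventually_at using d x by (intro exI[of _ "min d (x - pi / 2)"]) auto
qed

lemma layered:
  assumes tn: "turn b s" and ti: "tight b s" and m: "m \<ge> 1"
    and A: "angle b (pi / 2) = real (2 * (m - 1)) * pi + pi / 2"
    and eta: "\<eta> > 0" "pi / 2 - s \<le> \<eta>"
    and df: "\<And>t. s \<le> t \<Longrightarrow> t \<le> pi / 2 \<Longrightarrow> deficit b t \<le> (\<eta> * R)\<^sup>2 / 4"
  shows "\<exists>S T. layered_solution lam m ep (usol b) (usol' b) S T \<and> layer_error_le lam m \<eta> (usol b) S T"
proof -
  define n where "n = m - 1"
  note td = turnD[OF tn] and b0 = turn_start_neg[OF tn]
  obtain \<sigma> where \<sigma>: "\<And>k. k \<le> 2 * n \<Longrightarrow> s \<le> \<sigma> k \<and> \<sigma> k < pi / 2" "\<sigma> 0 = s"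
    "\<And>k l. k < l \<Longrightarrow> l \<le> 2 * n \<Longrightarrow> \<sigma> k < \<sigma> l"
    "\<And>x. s \<le> x \<Longrightarrow> x \<le> pi / 2 \<Longrightarrow> p b x = 0 \<longleftrightarrow> x \<in> \<sigma> ` {..2 * n}"
    and ev: "\<And>k. k \<le> 2 * n \<Longrightarrow> even k \<Longrightarrow> v b (\<sigma> k) < 0 \<and> 0 < force (v b (\<sigma> k)) (\<sigma> k)"
    and od: "\<And>k. k \<le> 2 * n \<Longrightarrow> odd k \<Longrightarrow> 0 < v b (\<sigma> k) \<and> force (v b (\<sigma> k)) (\<sigma> k) < 0"
    using critical_points[OF tn ti A[folded n_def]] by blast
  \<comment> \<open>\<open>\<sigma>\<close> counts from the turn towards \<pi>/2, against the
    direction of the original time; the turn itself is the last minimum \<open>S m\<close>.\<close>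
  define S where "S = (\<lambda>j. pi - \<sigma> (2 * (m - j)))"
  \<comment> \<open>For \<open>j = m\<close> truncated subtraction would give the index 0, a
    minimum; the last maximum is the end point instead.\<close>
  define T where "T = (\<lambda>j. if j = m then pi else pi - \<sigma> (2 * (m - j) - 1))"
  \<comment> \<open>Up to full turns the final angle is a right angle: the orbit passes 0 with
    \<open>p > 0\<close>, which is a negative slope after reversal.\<close>
  have end_angle: "sin (angle b (pi / 2)) = 1 \<and> cos (angle b (pi / 2)) = 0"
  proof -
    have e: "angle b (pi / 2) = pi / 2 + real (2 * n) * pi" using A by (simp add: n_def)
    show ?thesis unfolding e sin_add cos_add cos_npi sin_npi by simp
  qed
  have "0 \<le> pi / 2" by simp
  obtain r where r: "r > 0" "- v b (pi / 2) = r * cos (angle b (pi / 2))" "ep * p b (pi / 2) = r * sin (angle b (pi / 2))"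
    using polar[OF b0 turn_regular[OF tn ti] \<open>0 \<le> pi / 2\<close> order_refl] by metis
  have v_end: "v b (pi / 2) = 0" using r(2) end_angle by simp
  have "ep * p b (pi / 2) > 0" using r end_angle by simp
  then have p_end: "p b (pi / 2) > 0" using ep by (simp add: zero_less_mult_iff)
  have bd: "\<bar>v b t\<bar> < R" if "0 \<le> t" "t \<le> pi / 2" for t
  proof (cases "t \<le> s")
    case True
    have "v b s \<le> v b t" using True that td by (intro v_antimono) auto
    then show ?thesis using v_neg_before[OF tn that(1) True] td(6) R_pos by auto
  next
    case False
    then show ?thesis using trapped_weak[OF tn, of t] that by auto
  qed
  note ur = usol_right(1)[OF _ v_end] and ur' = usol_right(2)
  have sol: "forced_duffing_solution lam ep (usol b) (usol' b)"
    using bd by (intro usol_solution v_end) (auto intro: less_imp_le)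
  have uD: "DERIV (usol b) x :> usol' b x" if "0 < x" "x < pi" for x
  proof -
    have "at x within {0..pi} = at x" using that by (intro at_within_interior) auto
    moreover have "(usol b has_real_derivative usol' b x) (at x within {0..pi})"
      using sol that unfolding forced_duffing_solution_def by auto
    ultimately show ?thesis by simp
  qed
  have crit: "x = pi \<or> (\<exists>k\<le>2 * n. x = pi - \<sigma> k)"
    if x: "pi / 2 \<le> x" "x \<le> pi" and ext: "local_min_on (usol b) {0..pi} x \<or> local_max_on (usol b) {0..pi} x" for x
  proof (cases "x = pi")
    case False
    then have x': "0 < x" "x < pi" "0 < pi - x" using x pi_gt_zero by auto
    have "usol' b x = 0"
      using ext local_min_on_DERIV_zero[OF _ x'(1,2) uD[OF x'(1,2)]]
        local_max_on_DERIV_zero[OF _ x'(1,2) uD[OF x'(1,2)]] by blast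
    then have p0: "p b (pi - x) = 0" using ur'[OF x(1)] by simp
    have "s \<le> pi - x"
    proof (rule ccontr)
      assume "\<not> ?thesis"
      then have "p b (pi - x) < 0" using x' by (intro td(8)) auto
      then show False using p0 by simp
    qed
    then obtain k where "k \<le> 2 * n" "pi - x = \<sigma> k" using \<sigma>(4)[of "pi - x"] p0 x by auto
    then show ?thesis by (intro disjI2 exI[of _ k]) auto
  qed simp
  have p\<sigma>: "p b (\<sigma> k) = 0" if "k \<le> 2 * n" for k
    using \<sigma>(1)[OF that] \<sigma>(4)[of "\<sigma> k"] that by auto
  have mn: "local_min_on (usol b) {0..pi} (pi - \<sigma> k) \<and> \<not> local_max_on (usol b) {0..pi} (pi - \<sigma> k)"
    if k: "k \<le> 2 * n" "even k" for k
  proof -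
    have x: "pi / 2 < pi - \<sigma> k" "pi - \<sigma> k < pi" "0 < \<sigma> k" using \<sigma>(1)[OF k(1)] td by auto
    have "\<forall>\<^sub>F y in at (\<sigma> k). v b (\<sigma> k) < v b y"
      using ev[OF k] p\<sigma>[OF k(1)] x by (intro v_strict_min) auto
    then have "\<forall>\<^sub>F y in at (pi - \<sigma> k) within {0..pi}. pi / 2 \<le> y \<and> v b (\<sigma> k) < v b (pi - y)"
      using x by (intro eventually_reflect) auto
    then have "\<forall>\<^sub>F y in at (pi - \<sigma> k) within {0..pi}. usol b (pi - \<sigma> k) < usol b y"
      by eventually_elim (use x in \<open>simp add: ur\<close>)
    then show ?thesis using strict_local_min[of "pi - \<sigma> k" "usol b"] x by auto
  qed
  have mx: "local_max_on (usol b) {0..pi} (pi - \<sigma> k) \<and> \<not> local_min_on (usol b) {0..pi} (pi - \<sigma> k)"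
    if k: "k \<le> 2 * n" "odd k" for k
  proof -
    have x: "pi / 2 < pi - \<sigma> k" "pi - \<sigma> k < pi" "0 < \<sigma> k" using \<sigma>(1)[OF k(1)] td by auto
    have "\<forall>\<^sub>F y in at (\<sigma> k). v b y < v b (\<sigma> k)"
      using od[OF k] p\<sigma>[OF k(1)] x by (intro v_strict_max) auto
    then have "\<forall>\<^sub>F y in at (pi - \<sigma> k) within {0..pi}. pi / 2 \<le> y \<and> v b (pi - y) < v b (\<sigma> k)"
      using x by (intro eventually_reflect) auto
    then have "\<forall>\<^sub>F y in at (pi - \<sigma> k) within {0..pi}. usol b y < usol b (pi - \<sigma> k)"
      by eventually_elim (use x in \<open>simp add: ur\<close>)
    then show ?thesis using strict_local_max[of "pi - \<sigma> k" "usol b"] x by auto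
  qed
  \<comment> \<open>At the end point strictness comes from the fall of the orbit during the whole
    time \<open>s\<close> up to its turn.\<close>
  have mp: "local_max_on (usol b) {0..pi} pi \<and> \<not> local_min_on (usol b) {0..pi} pi"
  proof -
    have "usol b y < usol b pi" if y: "y \<in> {0..pi}" "y \<noteq> pi" "dist y pi < s" for y
    proof -
      have y': "pi - y < s" "0 < pi - y" "pi / 2 \<le> y" using y td by (auto simp: dist_real_def)
      have "v b (pi - y) < v b 0" using y' by (intro v_strict_antimono td(8)) auto
      then show ?thesis using ur[OF y'(3)] ur[of pi] by simp
    qed
    then have "\<forall>\<^sub>F y in at pi within {0..pi}. usol b y < usol b pi"
      unfolding eventually_at using td by (intro exI[of _ s]) auto
    then show ?thesis using strict_local_max[of pi "usol b"] by auto
  qed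
  have inj: "\<sigma> k = \<sigma> l \<longleftrightarrow> k = l" if "k \<le> 2 * n" "l \<le> 2 * n" for k l
    using \<sigma>(3)[of k l] \<sigma>(3)[of l k] that by (cases k l rule: linorder_cases) auto
  have jS: "2 * (m - j) \<le> 2 * n" if "j \<in> {1..m}" for j using that by (auto simp: n_def)
  have jT: "2 * (m - j) - 1 \<le> 2 * n" "odd (2 * (m - j) - 1)" if "j \<in> {1..<m}" for j
    using that by (auto simp: n_def)
  have half: "pi / 2 < pi - \<sigma> k" "pi - \<sigma> k < pi" if "k \<le> 2 * n" for k
    using \<sigma>(1)[OF that] td by auto
  have minS: "minima_right_half (usol b) = S ` {1..m}"
  proof (intro equalityI subsetI)
    fix x assume "x \<in> minima_right_half (usol b)"
    then have x: "pi / 2 \<le> x" "x \<le> pi" "local_min_on (usol b) {0..pi} x"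
      by (auto simp: minima_right_half_def)
    then have "x \<noteq> pi" using mp by auto
    then obtain k where k: "k \<le> 2 * n" "x = pi - \<sigma> k" using crit[OF x(1,2)] x(3) by auto
    then have "even k" using mx x(3) by blast
    then obtain i where i: "k = 2 * i" by blast
    then have "x = S (m - i)" "m - i \<in> {1..m}" using k m by (auto simp: S_def n_def)
    then show "x \<in> S ` {1..m}" by blast
  next
    fix x assume "x \<in> S ` {1..m}"
    then obtain j where j: "j \<in> {1..m}" "x = pi - \<sigma> (2 * (m - j))" by (auto simp: S_def)
    then show "x \<in> minima_right_half (usol b)"
      using mn[OF jS[OF j(1)]] half[OF jS[OF j(1)]] by (auto simp: minima_right_half_def)
  qed
  have maxT: "maxima_right_half (usol b) = T ` {1..m}"
  proof (intro equalityI subsetI)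
    fix x assume "x \<in> maxima_right_half (usol b)"
    then have x: "pi / 2 \<le> x" "x \<le> pi" "local_max_on (usol b) {0..pi} x"
      by (auto simp: maxima_right_half_def)
    show "x \<in> T ` {1..m}"
    proof (cases "x = pi")
      case True
      then show ?thesis using m by (intro image_eqI[of _ _ m]) (auto simp: T_def)
    next
      case False
      then obtain k where k: "k \<le> 2 * n" "x = pi - \<sigma> k" using crit[OF x(1,2)] x(3) by auto
      then have "odd k" using mn x(3) by blast
      then obtain i where i: "k = 2 * i + 1" by (rule oddE)
      then have "i + 1 \<le> n" using k by simp
      then have mi: "m - (i + 1) \<in> {1..<m}" "m - (m - (i + 1)) = i + 1" using m by (auto simp: n_def)
      then have "x = T (m - (i + 1))" using k i by (auto simp: T_def)
      moreover have "m - (i + 1) \<in> {1..m}" using mi(1) by auto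
      ultimately show ?thesis by blast
    qed
  next
    fix x assume "x \<in> T ` {1..m}"
    then obtain j where j: "j \<in> {1..m}" "x = T j" by auto
    show "x \<in> maxima_right_half (usol b)"
    proof (cases "j = m")
      case True
      then show ?thesis using j mp by (auto simp: maxima_right_half_def T_def)
    next
      case False
      then have j': "j \<in> {1..<m}" using j by auto
      show ?thesis
        using mx[OF jT[OF j']] half[OF jT(1)[OF j']] j False by (auto simp: maxima_right_half_def T_def)
    qed
  qed
  have injS: "inj_on S {1..m}"
  proof (rule inj_onI)
    fix i j assume ij: "i \<in> {1..m}" "j \<in> {1..m}" "S i = S j"
    then have "2 * (m - i) = 2 * (m - j)" using inj[OF jS[OF ij(1)] jS[OF ij(2)]] by (simp add: S_def)
    then show "i = j" using ij by auto
  qed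
  have injT: "inj_on T {1..m}"
  proof (rule inj_onI)
    fix i j assume ij: "i \<in> {1..m}" "j \<in> {1..m}" "T i = T j"
    have lt: "T k < pi" if "k \<in> {1..<m}" for k using half[OF jT(1)[OF that]] that by (simp add: T_def)
    show "i = j"
    proof (cases "i = m \<or> j = m")
      case True
      have "k = m \<longleftrightarrow> T k = pi" if "k \<in> {1..m}" for k
        using lt[of k] that by (cases "k = m") (auto simp: T_def)
      then show ?thesis using True ij by metis
    next
      case False
      then have ij': "i \<in> {1..<m}" "j \<in> {1..<m}" using ij by auto
      then have "2 * (m - i) - 1 = 2 * (m - j) - 1"
        using inj[OF jT(1)[OF ij'(1)] jT(1)[OF ij'(2)]] ij(3) by (simp add: T_def)
      then show ?thesis using ij' by auto
    qed
  qed
  have ST: "S j < T j" if j: "j \<in> {1..m}" for j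
  proof (cases "j = m")
    case True
    then show ?thesis using half[of 0] by (simp add: S_def T_def)
  next
    case False
    then have "\<sigma> (2 * (m - j) - 1) < \<sigma> (2 * (m - j))" using j by (intro \<sigma>(3) jS) auto
    then show ?thesis using False by (simp add: S_def T_def)
  qed
  have TS: "T j < S (j + 1)" if j: "j \<in> {1..<m}" for j
  proof -
    have "\<sigma> (2 * (m - (j + 1))) < \<sigma> (2 * (m - j) - 1)" using j by (intro \<sigma>(3) jT) auto
    then show ?thesis using j by (simp add: S_def T_def)
  qed
  \<comment> \<open>This is the stretch before the turn in reversed time: values lie between the
    turning level, above \<open>- R\<close>, and the starting level
    \<open>b \<le> U0\<close>.\<close>
  have last: "usol' b x > 0 \<and> U_lower lam (pi / 2) < usol b x \<and> usol b x < U_lower lam pi"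
    if x: "S m < x" "x < pi" for x
  proof -
    have y: "0 < pi - x" "pi - x < s" "pi / 2 \<le> x" using x \<sigma>(2) td by (auto simp: S_def)
    have "p b (pi - x) < 0" using y by (intro td(8)) auto
    moreover have "v b s \<le> v b (pi - x)" using y td by (intro v_antimono) auto
    moreover have "v b (pi - x) < v b 0" using y by (intro v_strict_antimono td(8)) auto
    ultimately show ?thesis
      using ur[OF y(3)] ur'[OF y(3)] td(1,6) by (simp add: U_half_pi v_0 flip: U0_def)
  qed
  have "layered_solution lam m ep (usol b) (usol' b) S T"
    unfolding layered_solution_def bij_betw_def
  proof (intro conjI sol ballI allI impI)
    show "usol' b 0 = 0" by (simp add: usol'_def p_0)
    show "usol' b pi = 0" by (simp add: usol'_def p_0)
    show "usol b (pi / 2) = 0" by (simp add: usol_def v_end)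
    show "usol' b (pi / 2) < 0" using p_end by (simp add: usol'_def)
    show "S ` {1..m} = minima_right_half (usol b)" by (simp add: minS)
    show "T ` {1..m} = maxima_right_half (usol b)" by (simp add: maxT)
    show "pi / 2 < S 1" using half[OF jS[of 1]] m by (simp add: S_def)
    show "T m = pi" by (simp add: T_def)
  qed (use injS injT ST TS last in auto)
  moreover have "layer_error_le lam m \<eta> (usol b) S T"
  proof -
    have dev: "\<bar>pi - \<sigma> k - pi / 2\<bar> \<le> \<eta>" "usol b (pi - \<sigma> k) = v b (\<sigma> k)" "\<bar>v b (\<sigma> k)\<bar> < R"
      "(lam - (v b (\<sigma> k))\<^sup>2)\<^sup>2 / 4 \<le> (\<eta> * R)\<^sup>2 / 4" if k: "k \<le> 2 * n" for k
    proof -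
      have \<sigma>k: "s \<le> \<sigma> k" "\<sigma> k < pi / 2" using \<sigma>(1)[OF k] by auto
      show "\<bar>pi - \<sigma> k - pi / 2\<bar> \<le> \<eta>" using \<sigma>k eta by simp
      show "usol b (pi - \<sigma> k) = v b (\<sigma> k)" using ur[of "pi - \<sigma> k"] \<sigma>k by simp
      show "\<bar>v b (\<sigma> k)\<bar> < R" using bd[of "\<sigma> k"] \<sigma>k td by simp
      \<comment> \<open>At a critical point the deficit is purely potential.\<close>
      show "(lam - (v b (\<sigma> k))\<^sup>2)\<^sup>2 / 4 \<le> (\<eta> * R)\<^sup>2 / 4"
        using df[of "\<sigma> k"] \<sigma>k p\<sigma>[OF k] by (simp add: deficit_def)
    qed
    have "\<bar>S j - pi / 2\<bar> \<le> \<eta> \<and> \<bar>usol b (S j) - U_lower lam (pi / 2)\<bar> \<le> \<eta>" if j: "j \<in> {1..m}" for j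
      using dev[OF jS[OF j]] ev[OF jS[OF j]] near_R(1)[of "v b (\<sigma> (2 * (m - j)))" \<eta>] eta
      unfolding S_def U_half_pi by auto
    moreover have "\<bar>T j - pi / 2\<bar> \<le> \<eta> \<and> \<bar>usol b (T j) - U_upper lam (pi / 2)\<bar> \<le> \<eta>" if j: "j \<in> {1..<m}" for j
      using dev[OF jT(1)[OF j]] od[OF jT[OF j]] near_R(2)[of "v b (\<sigma> (2 * (m - j) - 1))" \<eta>] eta j
      unfolding T_def U_half_pi by auto
    ultimately show ?thesis unfolding layer_error_le_def by blast
  qed
  ultimately show ?thesis by blast
qed

end

section \<open>Choice of the constants\<close>

context supercritical
begin

text \<open>\<open>\<rho>\<close> controls the turning level, \<open>\<delta>\<close> the time between the last minimum and \<open>\<pi>/2\<close>, and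
  the last two bounds on \<open>\<epsilon>\<close> force the turning level and the number of turns, respectively.\<close>

lemma layered_exists:
  assumes m: "m \<ge> 1" and eta: "\<eta> > 0"
  shows "\<exists>e>0. \<forall>ep\<in>{0<..<e}. \<exists>u u' s t. layered_solution lam m ep u u' s t \<and> layer_error_le lam m \<eta> u s t"
proof -
  \<comment> \<open>\<open>\<mu>\<close> bounds the squared level term. It may use up half of the
    allowance \<open>lam\<^sup>2 / 16\<close> in \<open>tight\<close> and half of the admissible
    deficit \<open>(\<eta> * R)\<^sup>2 / 4\<close>; \<open>\<delta>\<close> gets the other
    halves.\<close>
  define \<mu> where "\<mu> = min (lam\<^sup>2 / 16) ((\<eta> * R)\<^sup>2 / 2)"
  \<comment> \<open>A level within \<open>\<rho>\<close> of \<open>- R\<close> makes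
    \<open>(R - v) * (R + v)\<close> at most \<open>2 * R * \<rho> \<le> sqrt \<mu>\<close>; the
    second bound stays on the increasing branch of \<open>h\<close>.\<close>
  define \<rho> where "\<rho> = min (sqrt \<mu> / (2 * R)) (R - a)"
  define d where "d = min 1 (h (- R + \<rho>) / 2)"
  define \<delta> where "\<delta> = min (min (d / 2) \<eta>) (min (lam\<^sup>2 / (288 * R)) (\<eta>\<^sup>2 * R / 32))"
  define L where "L = lam + lam\<^sup>2 / 2"
  define A where "A = real (2 * (m - 1)) * pi + pi / 2"
  \<comment> \<open>The bound 1 gives \<open>ep\<^sup>2 \<le> ep\<close>, so that the second bound
    can be linear in \<open>ep\<close>.\<close>
  define e where "e = min (min 1 (h (- R + \<rho>) * d\<^sup>2 / (32 * R))) (\<delta> / 4 * spin_bound \<delta> / (A * L))"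
  have mu: "0 < \<mu>" "\<mu> \<le> lam\<^sup>2 / 16" "\<mu> \<le> (\<eta> * R)\<^sup>2 / 2"
    using lam_pos R_pos eta by (auto simp: \<mu>_def)
  have rho: "0 < \<rho>" "- R + \<rho> \<le> - a" "\<rho> \<le> sqrt \<mu> / (2 * R)"
    using mu R_pos a_less_R by (auto simp: \<rho>_def)
  have h0: "0 < h (- R + \<rho>)" using h_strict_mono[of "- R" "- R + \<rho>"] rho h_R by simp
  have d: "0 < d" "d \<le> 1" "2 * d \<le> h (- R + \<rho>)" using h0 by (auto simp: d_def)
  have del: "0 < \<delta>" "\<delta> \<le> d / 2" "\<delta> \<le> \<eta>" "\<delta> \<le> lam\<^sup>2 / (288 * R)" "\<delta> \<le> \<eta>\<^sup>2 * R / 32"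
    using d eta lam_pos R_pos by (auto simp: \<delta>_def)
  have del2: "\<delta> < pi / 2" using del d pi_gt3 by linarith
  have R1: "9 * R * \<delta> \<le> lam\<^sup>2 / 32" using del(4) R_pos by (simp add: field_simps)
  have "\<delta> * R \<le> (\<eta>\<^sup>2 * R / 32) * R" using del(5) R_pos by (intro mult_right_mono) auto
  then have R2: "4 * R * \<delta> \<le> (\<eta> * R)\<^sup>2 / 8" by (simp add: power2_eq_square mult_ac)
  have L: "0 < L" using lam_pos by (simp add: L_def add_pos_pos)
  have A: "pi / 2 \<le> A" by (simp add: A_def)
  then have A0: "0 < A" using pi_half_gt_zero by linarith
  have "0 < e" using h0 d del del2 spin_bound_pos L A0 R_pos by (auto simp: e_def)
  moreover have "\<exists>u u' s t. layered_solution lam m ep u u' s t \<and> layer_error_le lam m \<eta> u s t"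
    if ep: "ep \<in> {0<..<e}" for ep
  proof -
    have ep': "0 < ep" "ep < 1" "ep < h (- R + \<rho>) * d\<^sup>2 / (32 * R)" "ep < \<delta> / 4 * spin_bound \<delta> / (A * L)"
      using ep by (auto simp: e_def)
    obtain v q where "shooting lam ep v q" using shooting_exists[OF ep'(1)] by blast
    then interpret S: shooting lam ep v q .
    have "32 * R * ep < h (- R + \<rho>) * d\<^sup>2" using ep'(3) R_pos by (simp add: field_simps)
    moreover have "32 * R * ep\<^sup>2 \<le> 32 * R * ep"
      using ep' R_pos by (simp add: power2_eq_square mult_le_cancel_left1)
    ultimately have e32: "32 * ep\<^sup>2 * R < h (- R + \<rho>) * d\<^sup>2" by (simp add: mult_ac)
    have level: "(lam - (v b s)\<^sup>2)\<^sup>2 \<le> \<mu>" if tn: "S.turn b s" and s: "pi / 2 - \<delta> \<le> s" for b s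
    proof -
      have c: "v b s < - R + \<rho>"
        by (rule S.turn_level_near[OF tn rho(2) d _ e32]) (use s del in linarith)
      have "- R < v b s" "v b s < 0" using S.turnD(6)[OF tn] S.turn_level_neg[OF tn] by auto
      then have nn: "0 \<le> lam - (v b s)\<^sup>2" using abs_less_R[of "v b s"] R_pos by auto
      have "lam - (v b s)\<^sup>2 = (R - v b s) * (R + v b s)"
        using R_mult by (simp add: algebra_simps power2_eq_square)
      also have "\<dots> \<le> (2 * R) * \<rho>"
        using c \<open>- R < v b s\<close> R_pos by (intro mult_mono) auto
      also have "\<dots> \<le> sqrt \<mu>" using rho(3) R_pos by (simp add: field_simps)
      finally have "(lam - (v b s)\<^sup>2)\<^sup>2 \<le> (sqrt \<mu>)\<^sup>2" using nn by (intro power_mono) auto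
      then show ?thesis using mu by simp
    qed
    have short: "4 * R * (pi / 2 - s) \<le> 4 * R * \<delta>" "9 * R * (pi / 2 - s) \<le> 9 * R * \<delta>" if "pi / 2 - \<delta> \<le> s" for s
      using that R_pos by (auto intro!: mult_left_mono)
    have tight: "S.tight b s" if "S.turn b s" "pi / 2 - \<delta> \<le> s" for b s
      using level[OF that] short[OF that(2)] R1 mu unfolding S.tight_def by linarith
    have "A * (ep * L) \<le> \<delta> / 4 * spin_bound \<delta>" using ep'(4) A0 L by (simp add: field_simps)
    then have "A \<le> \<delta> / 4 * (spin_bound \<delta> / (ep * L))" using ep' L by (simp add: field_simps)
    then have grow: "A \<le> (pi / 2 - (pi / 2 - \<delta>)) / 4 * (spin_bound (pi / 2 - (pi / 2 - \<delta>)) / (ep * (lam + lam\<^sup>2 / 2)))"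
      by (simp add: L_def)
    have T: "0 < pi / 2 - \<delta>" "pi / 2 - \<delta> < pi / 2" using del del2 by auto
    obtain b s where bs: "S.turn b s" "pi / 2 - \<delta> \<le> s" "S.angle b (pi / 2) = A"
      using S.orbit_exists[OF T tight A grow] by metis
    have "S.deficit b t \<le> (\<eta> * R)\<^sup>2 / 4" if "s \<le> t" "t \<le> pi / 2" for t
      using S.deficit_bounds(2)[OF bs(1) that] level[OF bs(1,2)] short(1)[OF bs(2)] R2 mu by linarith
    moreover have "pi / 2 - s \<le> \<eta>" using bs(2) del(3) by linarith
    ultimately show ?thesis
      using S.layered[OF bs(1) tight[OF bs(1,2)] m bs(3)[unfolded A_def] eta] by blast
  qed
  ultimately show ?thesis by blast
qed

end

theorem theorem33:
  fixes lam :: real and m :: nat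
  assumes "lam > 3 / 2 powr (2 / 3)" and "m \<ge> 1"
  shows "\<exists>\<epsilon>\<^sub>m > 0. \<exists>(u :: real \<Rightarrow> real \<Rightarrow> real) (u' :: real \<Rightarrow> real \<Rightarrow> real)
            (s :: real \<Rightarrow> nat \<Rightarrow> real) (t :: real \<Rightarrow> nat \<Rightarrow> real).
      (\<forall>\<epsilon> \<in> {0<..<\<epsilon>\<^sub>m}.
         forced_duffing_solution lam \<epsilon> (u \<epsilon>) (u' \<epsilon>) \<and>
         u' \<epsilon> 0 = 0 \<and> u' \<epsilon> pi = 0 \<and> u \<epsilon> (pi/2) = 0 \<and> u' \<epsilon> (pi/2) < 0 \<and>
         bij_betw (s \<epsilon>) {1..m} (minima_right_half (u \<epsilon>)) \<and>
         bij_betw (t \<epsilon>) {1..m} (maxima_right_half (u \<epsilon>)) \<and>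
         pi/2 < s \<epsilon> 1 \<and>
         (\<forall>j \<in> {1..m}. s \<epsilon> j < t \<epsilon> j) \<and>
         (\<forall>j \<in> {1..<m}. t \<epsilon> j < s \<epsilon> (j + 1)) \<and>
         t \<epsilon> m = pi \<and>
         (\<forall>x. s \<epsilon> m < x \<and> x < pi \<longrightarrow>
            u' \<epsilon> x > 0 \<and> U_lower lam (pi/2) < u \<epsilon> x \<and> u \<epsilon> x < U_lower lam pi)) \<and>
      (\<forall>j \<in> {1..m}.
         ((\<lambda>\<epsilon>. s \<epsilon> j) \<longlongrightarrow> pi/2) (at_right 0) \<and>
         ((\<lambda>\<epsilon>. u \<epsilon> (s \<epsilon> j)) \<longlongrightarrow> U_lower lam (pi/2)) (at_right 0)) \<and>
      (\<forall>j \<in> {1..<m}.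
         ((\<lambda>\<epsilon>. t \<epsilon> j) \<longlongrightarrow> pi/2) (at_right 0) \<and>
         ((\<lambda>\<epsilon>. u \<epsilon> (t \<epsilon> j)) \<longlongrightarrow> U_upper lam (pi/2)) (at_right 0))"
proof -
  interpret supercritical lam by unfold_locales (rule assms)
  define P where "P = (\<lambda>\<epsilon> (u, u', s, t). layered_solution lam m \<epsilon> u u' s t)"
  define C where "C = (\<lambda>\<eta> (u, u' :: real \<Rightarrow> real, s, t). layer_error_le lam m \<eta> u s t)"
  obtain e f where e: "e > 0" "\<And>x. x \<in> {0<..<e} \<Longrightarrow> P x (f x)"
    and C: "\<And>\<eta>. \<eta> > 0 \<Longrightarrow> \<forall>\<^sub>F x in at_right 0. C \<eta> (f x)"
  proof (rule choose_vanishing[of P C])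
    show "\<exists>e>0. \<forall>x\<in>{0<..<e}. \<exists>y. P x y \<and> C \<eta> y" if "\<eta> > 0" for \<eta>
      using layered_exists[OF assms(2) that] unfolding P_def C_def by auto
    show "C \<eta>' y" if "C \<eta> y" "\<eta> \<le> \<eta>'" for \<eta> \<eta>' y
      using that unfolding C_def layer_error_le_def by (auto split: prod.splits; force)
  qed blast
  define u where "u = (\<lambda>x. fst (f x))"
  define u' where "u' = (\<lambda>x. fst (snd (f x)))"
  define s where "s = (\<lambda>x. fst (snd (snd (f x))))"
  define t where "t = (\<lambda>x. snd (snd (snd (f x))))"
  have sol: "layered_solution lam m x (u x) (u' x) (s x) (t x)" if "x \<in> {0<..<e}" for x
    using e(2)[OF that] by (simp add: P_def u_def u'_def s_def t_def case_prod_unfold)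
  have err: "\<forall>\<^sub>F x in at_right 0. layer_error_le lam m \<eta> (u x) (s x) (t x)" if "\<eta> > 0" for \<eta>
    using C[OF that] by (simp add: C_def u_def s_def t_def case_prod_unfold)
  have lim: "(g \<longlongrightarrow> l) (at_right 0)"
    if "\<And>\<eta> x. layer_error_le lam m \<eta> (u x) (s x) (t x) \<Longrightarrow> \<bar>g x - l\<bar> \<le> \<eta>" for g :: "real \<Rightarrow> real" and l
  proof (rule tendstoI)
    fix \<eta> :: real assume "\<eta> > 0"
    then have "\<forall>\<^sub>F x in at_right 0. layer_error_le lam m (\<eta> / 2) (u x) (s x) (t x)" by (intro err) simp
    then show "\<forall>\<^sub>F x in at_right 0. dist (g x) l < \<eta>"
    proof eventually_elim
      case (elim x)
      then show ?case using that[of "\<eta> / 2" x] \<open>\<eta> > 0\<close> by (simp add: dist_real_def)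
    qed
  qed
  have S: "\<forall>j \<in> {1..m}. ((\<lambda>\<epsilon>. s \<epsilon> j) \<longlongrightarrow> pi / 2) (at_right 0) \<and>
      ((\<lambda>\<epsilon>. u \<epsilon> (s \<epsilon> j)) \<longlongrightarrow> U_lower lam (pi / 2)) (at_right 0)"
    by (intro ballI conjI lim) (auto simp: layer_error_le_def)
  have T: "\<forall>j \<in> {1..<m}. ((\<lambda>\<epsilon>. t \<epsilon> j) \<longlongrightarrow> pi / 2) (at_right 0) \<and>
      ((\<lambda>\<epsilon>. u \<epsilon> (t \<epsilon> j)) \<longlongrightarrow> U_upper lam (pi / 2)) (at_right 0)"
    by (intro ballI conjI lim) (auto simp: layer_error_le_def)
  show ?thesis
    by (rule exI[of _ e], rule conjI[OF e(1)], rule exI[of _ u], rule exI[of _ u'],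
        rule exI[of _ s], rule exI[of _ t],
        rule conjI[OF ballI[OF sol[unfolded layered_solution_def]] conjI[OF S T]])
qed

end
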